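(* Let $\lambda>0$ and let $\mathcal H$ be a homogeneous Poisson point process on $\mathbb H^+=\mathbb R\times\mathbb R^+$ with intensity $dt\otimes 2\lambda\,dh$ (the head point process of unit-speed stations), with law $\mathbb P$ on the canonical space of point configurations on $\mathbb H^+$, shift $\theta_s(\sum_i\delta_{(T_i,H_i)})=\sum_i\delta_{(T_i-s,H_i)}$, and let $\mathbb P^0_{\mathcal V}$ be the Palm probability of the handover point process $\mathcal V$. Then for every measurable $f\ge0$, $$\mathbb E^0_{\mathcal V}[f(\mathcal H)]=\pi\lambda^{3/2}\int_{(\mathbb R^+)^3}\mathbb E\Big[\mathbf 1_{\{\mathcal H(U^{\hat s}_{\hat h})=0\}}\,f\big(\theta_{\hat s}(\mathcal H+\delta_{(0,h)}+\delta_{(-t',h')})\big)\Big]\,dt'\,dh'\,dh,$$ where $\hat s=\hat s(0,h,-t',h')$ and $\hat h=\hat h(0,h,-t',h')$.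
   Context: To a head $(t_0,h_0)\in\mathbb H^+$ associate the radial bird $C_{(t_0,h_0)}=\{(t,((t-t_0)^2+h_0^2)^{1/2}):t\in\mathbb R\}$ (distance to the origin over time of a unit-speed station with closest approach $h_0$ at time $t_0$). Two birds with heads $(t_1,h_1),(t_2,h_2)$, $t_1\neq t_2$, intersect in exactly one point $(\hat s,\hat h)$ with $\hat s(t_1,h_1,t_2,h_2)=\frac{t_1^2+h_1^2-t_2^2-h_2^2}{2(t_1-t_2)}$ and $\hat h^2(t_1,h_1,t_2,h_2)=\frac14\big[(t_1-t_2)^2+2(h_1^2+h_2^2)+\frac{(h_2^2-h_1^2)^2}{(t_1-t_2)^2}\big]$. $U^s_r=\{(x,y):y>0,(x-s)^2+y^2<r^2\}$. The handover point process $\mathcal V$ on $\mathbb R$ consists of the abscissas $\hat s$ of intersections $(\hat s,\hat h)$ of pairs of birds with heads in $\mathcal H$ such that $\mathcal H(U^{\hat s}_{\hat h})=0$ (these are the times the closest station changes); it is stationary with intensity $4\sqrt\lambda/\pi$. $\mathbb E$ denotes expectation under $\mathbb P$. *)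

theory Defs
  imports "HOL-Probability.Probability"
begin

definition Hplus :: "(real \<times> real) set" where
  "Hplus = {(t, h). h > 0}"

definition configs :: "(real \<times> real) set set" where
  "configs = {N. N \<subseteq> Hplus \<and> (\<forall>B. bounded B \<longrightarrow> finite (N \<inter> B))}"

definition config_space :: "(real \<times> real) set measure" where
  "config_space = sigma configs
     {{N \<in> configs. card (N \<inter> B) = k} | B k. B \<in> sets borel \<and> bounded B}"

definition poisson_head_law :: "real \<Rightarrow> (real \<times> real) set measure \<Rightarrow> bool" where
  "poisson_head_law lam P \<longleftrightarrow> prob_space P \<and> sets P = sets config_space \<and>
     (\<forall>(n::nat) (B :: nat \<Rightarrow> (real \<times> real) set) (k :: nat \<Rightarrow> nat).
        (\<forall>i<n. B i \<in> sets borel \<and> bounded (B i) \<and> B i \<subseteq> Hplus) \<and> disjoint_family_on B {..<n}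
        \<longrightarrow> measure P {N \<in> space P. \<forall>i<n. card (N \<inter> B i) = k i}
            = (\<Prod>i<n. exp (- (2 * lam * measure lborel (B i)))
                        * (2 * lam * measure lborel (B i)) ^ k i / fact (k i)))"

definition shift :: "real \<Rightarrow> (real \<times> real) set \<Rightarrow> (real \<times> real) set" where
  "shift s N = (\<lambda>(t, h). (t - s, h)) ` N"

definition U_half :: "real \<Rightarrow> real \<Rightarrow> (real \<times> real) set" where
  "U_half s r = {(x, y). y > 0 \<and> (x - s)\<^sup>2 + y\<^sup>2 < r\<^sup>2}"

definition s_hat :: "real \<Rightarrow> real \<Rightarrow> real \<Rightarrow> real \<Rightarrow> real" where
  "s_hat t1 h1 t2 h2 = (t1\<^sup>2 + h1\<^sup>2 - t2\<^sup>2 - h2\<^sup>2) / (2 * (t1 - t2))"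

definition h_hat_sq :: "real \<Rightarrow> real \<Rightarrow> real \<Rightarrow> real \<Rightarrow> real" where
  "h_hat_sq t1 h1 t2 h2 = (1/4) * ((t1 - t2)\<^sup>2 + 2 * (h1\<^sup>2 + h2\<^sup>2) + (h2\<^sup>2 - h1\<^sup>2)\<^sup>2 / (t1 - t2)\<^sup>2)"

definition h_hat :: "real \<Rightarrow> real \<Rightarrow> real \<Rightarrow> real \<Rightarrow> real" where
  "h_hat t1 h1 t2 h2 = sqrt (h_hat_sq t1 h1 t2 h2)"

text \<open>Handover point process: abscissas of bird intersections whose half-disk is empty.\<close>
definition handover :: "(real \<times> real) set \<Rightarrow> real set" where
  "handover N = {s_hat t1 h1 t2 h2 | t1 h1 t2 h2.
      (t1, h1) \<in> N \<and> (t2, h2) \<in> N \<and> t1 \<noteq> t2 \<and>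
      N \<inter> U_half (s_hat t1 h1 t2 h2) (h_hat t1 h1 t2 h2) = {}}"

text \<open>Palm expectation of a stationary point process V (on R, built from the
  configuration) under P, via the window [0,1]:
  E^0_V[f] = E[ sum_{s in V cap [0,1]} f(theta_s) ] / intensity.\<close>
definition palm_expectation ::
  "(real \<times> real) set measure \<Rightarrow> ((real \<times> real) set \<Rightarrow> real set)
     \<Rightarrow> ((real \<times> real) set \<Rightarrow> ennreal) \<Rightarrow> ennreal" where
  "palm_expectation P V f =
     (\<integral>\<^sup>+ N. (\<integral>\<^sup>+ s. f (shift s N) \<partial>count_space (V N \<inter> {0..1})) \<partial>P)
     / (\<integral>\<^sup>+ N. emeasure (count_space (V N \<inter> {0..1})) (V N \<inter> {0..1}) \<partial>P)"

end

theory Submission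
  imports Defs
begin

text \<open>
  A handover in \<open>[0, 1]\<close> almost surely comes from exactly one pair of heads, because almost surely no
  three heads lie on a common half-circle centred on the time axis. The numerator of the Palm
  expectation is therefore a double sum over the configuration, to which the Mecke formula applies
  twice. By stationarity the integrand depends on the abscissa of the first head only through the
  indicator that the handover lies in \<open>[0, 1]\<close>, and integrating this variable out gives
  \<open>4 \<lambda>\<^sup>2\<close> times the triple integral of the theorem, without its constant. The denominator is the case
  \<open>f = 1\<close>, where the emptiness probability of a half-disk of radius \<open>r\<close> is \<open>exp (- \<pi> \<lambda> r\<^sup>2)\<close> and the
  integral can be evaluated in closed form.
\<close>

section \<open>Measurability on the configuration space\<close>

text \<open>The hypothesis on \<open>P\<close> only fixes joint laws of counts on bounded Borel
  sets, so the Mecke formula itself has to be derived. Void events make this cheap: on a rectangle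
  \<open>a \<times> void_event D\<close> the formula amounts to the mean of a Poisson count on a set
  disjoint from \<open>D\<close> times the probability that \<open>D\<close> is empty, and such
  rectangles form an intersection-stable generator. Shift invariance is checked on void events as
  well.

  The set-valued \<open>handover\<close> hides multiplicities and offers no direct handle on
  measurability. Ordering each pair by abscissa, \<open>fst q < fst p\<close>, lists every pair
  once, hence no factor 1/2 appears, and replaces the sum over abscissas by a measurable double sum
  that agrees with it almost surely.

  The constant is a quotient. Each head contributes a factor \<open>2 * lam\<close>, and the triple
  integral for \<open>f = 1\<close> equals 1 / (pi lam^(3/2)). The intensity is therefore 4 lam^2 /
  (pi lam^(3/2)) = 4 sqrt(lam) / pi, and dividing by it turns 4 lam^2 into pi lam^(3/2).\<close>

lemma borel_measurable_fst_borel [measurable]: "fst \<in> borel_measurable (borel :: (real \<times> real) measure)"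
  by (intro borel_measurable_continuous_onI continuous_intros)

lemma borel_measurable_snd_borel [measurable]: "snd \<in> borel_measurable (borel :: (real \<times> real) measure)"
  by (intro borel_measurable_continuous_onI continuous_intros)

section \<open>Void events and grid cells\<close>

definition void_event :: "(real \<times> real) set \<Rightarrow> (real \<times> real) set set" where
  "void_event D = {N \<in> configs. N \<inter> D = {}}"

text \<open>The index of the half-open square of side 1/n that contains \<open>p\<close>. Integer
  indices keep the collection of cells countable.\<close>

definition cell :: "nat \<Rightarrow> real \<times> real \<Rightarrow> int \<times> int" where
  "cell n p = (\<lfloor>real n * fst p\<rfloor>, \<lfloor>real n * snd p\<rfloor>)"

text \<open>Reals with equal floor differ by less than 1, while n |x - y| exceeds 1 from some n on.
  Holding for all large n, and not just for one, is what allows finitely many pairs to be separated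
  by the same grid.\<close>

lemma eventually_floor_neq:
  fixes x y :: real
  assumes "x \<noteq> y"
  shows "\<forall>\<^sub>F n in sequentially. \<lfloor>real n * x\<rfloor> \<noteq> \<lfloor>real n * y\<rfloor>"
proof -
  obtain m :: nat where m: "real m > 1 / \<bar>x - y\<bar>"
    using reals_Archimedean2 by blast
  have "\<lfloor>real n * x\<rfloor> \<noteq> \<lfloor>real n * y\<rfloor>" if "n \<ge> m" for n
  proof
    assume "\<lfloor>real n * x\<rfloor> = \<lfloor>real n * y\<rfloor>"
    then have "\<bar>real n * x - real n * y\<bar> < 1"
      by linarith
    moreover have "\<bar>real n * x - real n * y\<bar> = real n * \<bar>x - y\<bar>"
      by (simp add: abs_mult flip: right_diff_distrib)
    moreover have "real n * \<bar>x - y\<bar> \<ge> real m * \<bar>x - y\<bar>"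
      using that by (intro mult_right_mono) auto
    moreover have "real m * \<bar>x - y\<bar> > 1"
      using m assms by (simp add: field_simps)
    ultimately show False by linarith
  qed
  then show ?thesis
    by (auto simp: eventually_sequentially)
qed

lemma ex_cell_inj_on:
  assumes "finite F"
  shows "\<exists>n. inj_on (cell n) F"
proof -
  have "\<forall>\<^sub>F n in sequentially. fst z \<noteq> snd z \<longrightarrow> cell n (fst z) \<noteq> cell n (snd z)" for z
  proof (cases "fst (fst z) = fst (snd z)")
    case True
    show ?thesis
    proof (cases "snd (fst z) = snd (snd z)")
      case False
      then show ?thesis
        using eventually_floor_neq[OF False] by eventually_elim (simp add: cell_def)
    qed (use True in \<open>simp add: prod_eq_iff\<close>)
  next
    case False
    then show ?thesis
      using eventually_floor_neq[OF False] by eventually_elim (simp add: cell_def)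
  qed
  then have "\<forall>\<^sub>F n in sequentially. \<forall>z\<in>F \<times> F. fst z \<noteq> snd z \<longrightarrow> cell n (fst z) \<noteq> cell n (snd z)"
    using assms by (intro eventually_ball_finite) auto
  then obtain n where "\<forall>z\<in>F \<times> F. fst z \<noteq> snd z \<longrightarrow> cell n (fst z) \<noteq> cell n (snd z)"
    unfolding eventually_sequentially by blast
  then show ?thesis
    by (intro exI[of _ n]) (auto simp: inj_on_def)
qed

text \<open>Occupied cells never overcount, since distinct cells hold distinct points; they
  undercount only while two points share a cell, which a fine enough grid excludes. The right-hand
  side is a countable combination of emptiness conditions.\<close>

lemma le_card_iff_cells:
  assumes "finite (N \<inter> B)"
  shows "k \<le> card (N \<inter> B) \<longleftrightarrow>
    (\<exists>n. \<exists>S\<in>{S. finite S \<and> card S = k}. \<forall>z\<in>S. N \<inter> (B \<inter> cell n -` {z}) \<noteq> {})"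
proof
  assume k: "k \<le> card (N \<inter> B)"
  obtain n where n: "inj_on (cell n) (N \<inter> B)"
    using ex_cell_inj_on[OF assms] by blast
  then have "k \<le> card (cell n ` (N \<inter> B))"
    using k by (simp add: card_image)
  then obtain S where "S \<subseteq> cell n ` (N \<inter> B)" "card S = k" "finite S"
    by (metis obtain_subset_with_card_n)
  then show "\<exists>n. \<exists>S\<in>{S. finite S \<and> card S = k}. \<forall>z\<in>S. N \<inter> (B \<inter> cell n -` {z}) \<noteq> {}"
    by (intro exI[of _ n] bexI[of _ S] ballI) blast+
next
  assume "\<exists>n. \<exists>S\<in>{S. finite S \<and> card S = k}. \<forall>z\<in>S. N \<inter> (B \<inter> cell n -` {z}) \<noteq> {}"
  then obtain n S where S: "finite S" "card S = k" "\<forall>z\<in>S. N \<inter> (B \<inter> cell n -` {z}) \<noteq> {}"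
    by auto
  have "S \<subseteq> cell n ` (N \<inter> B)"
  proof
    fix z assume "z \<in> S"
    then have "N \<inter> (B \<inter> cell n -` {z}) \<noteq> {}" using S(3) by blast
    then show "z \<in> cell n ` (N \<inter> B)" by blast
  qed
  then have "card S \<le> card (cell n ` (N \<inter> B))"
    using assms by (intro card_mono) auto
  also have "\<dots> \<le> card (N \<inter> B)"
    using assms by (rule card_image_le)
  finally show "k \<le> card (N \<inter> B)" using S by simp
qed

lemma space_config_space [simp]: "space config_space = configs"
  unfolding config_space_def by (rule space_measure_of) auto

lemma finite_config_Int: "N \<in> configs \<Longrightarrow> bounded B \<Longrightarrow> finite (N \<inter> B)"
  by (auto simp: configs_def)

text \<open>Counts are recovered from void events by covering with ever finer grid cells. The void events
  are stable under intersection and have explicit probabilities, so all later uniqueness arguments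
  only involve them.\<close>

lemma sets_config_space_void:
  "sets config_space = sigma_sets configs {void_event D |D. D \<in> sets borel \<and> bounded D}"
  (is "_ = sigma_sets configs ?V")
proof -
  let ?K = "{{N \<in> configs. card (N \<inter> B) = k} | B k. B \<in> sets borel \<and> bounded B}"
  have K: "?K \<subseteq> Pow configs" and V: "?V \<subseteq> Pow configs" by (auto simp: void_event_def)
  have c: "sets config_space = sigma_sets configs ?K"
    unfolding config_space_def using K by (rule sets_measure_of)
  define M where "M = sigma configs ?V"
  have M: "sets M = sigma_sets configs ?V" "space M = configs"
    using V by (auto simp: M_def sets_measure_of space_measure_of)
  have vM: "void_event D \<in> sets M" if "D \<in> sets borel" "bounded D" for D
    unfolding M using that by (intro sigma_sets.Basic) auto
  have cellm: "cell n -` {z} \<in> sets borel" for n z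
  proof -
    have "cell n -` {z} = {p. \<lfloor>real n * fst p\<rfloor> = fst z \<and> \<lfloor>real n * snd p\<rfloor> = snd z}"
      by (auto simp: cell_def)
    also have "\<dots> \<in> sets borel" by measurable
    finally show ?thesis .
  qed
  have ge: "{N \<in> configs. k \<le> card (N \<inter> B)} \<in> sets M" if B: "B \<in> sets borel" "bounded B" for B k
  proof -
    have "(\<Union>n. \<Union>S\<in>{S. finite S \<and> card S = k}. {N \<in> space M. \<forall>z\<in>S. N \<inter> (B \<inter> cell n -` {z}) \<noteq> {}}) \<in> sets M"
    proof (intro sets.countable_UN'')
      show "countable {S :: (int \<times> int) set. finite S \<and> card S = k}"
        by (rule countable_subset[OF _ countable_Collect_finite]) auto
    next
      fix n S
      show "{N \<in> space M. \<forall>z\<in>S. N \<inter> (B \<inter> cell n -` {z}) \<noteq> {}} \<in> sets M"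
      proof (rule sets.sets_Collect_countable_Ball)
        fix z
        have "space M - void_event (B \<inter> cell n -` {z}) \<in> sets M"
          using B cellm by (intro sets.compl_sets vM) (auto intro: bounded_subset)
        also have "space M - void_event (B \<inter> cell n -` {z}) =
            {N \<in> space M. N \<inter> (B \<inter> cell n -` {z}) \<noteq> {}}"
          by (auto simp: void_event_def M)
        finally show "{N \<in> space M. N \<inter> (B \<inter> cell n -` {z}) \<noteq> {}} \<in> sets M" .
      qed
    qed simp
    also have "(\<Union>n. \<Union>S\<in>{S. finite S \<and> card S = k}. {N \<in> space M. \<forall>z\<in>S. N \<inter> (B \<inter> cell n -` {z}) \<noteq> {}}) =
        {N \<in> configs. k \<le> card (N \<inter> B)}"
      by (rule set_eqI) (simp add: M(2) le_card_iff_cells[OF finite_config_Int[OF _ B(2)]] cong: conj_cong)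
    finally show ?thesis .
  qed
  have "?K \<subseteq> sets M"
  proof
    fix X assume "X \<in> ?K"
    then obtain B k where X: "X = {N \<in> configs. card (N \<inter> B) = k}" and B: "B \<in> sets borel" "bounded B"
      by auto
    have "X = {N \<in> configs. k \<le> card (N \<inter> B)} - {N \<in> configs. Suc k \<le> card (N \<inter> B)}"
      by (auto simp: X)
    then show "X \<in> sets M" using ge[OF B] by auto
  qed
  then have "sigma_sets configs ?K \<subseteq> sets M"
    using sets.sigma_sets_subset[of ?K M] M(2) by simp
  moreover have "?V \<subseteq> sigma_sets configs ?K"
  proof
    fix X assume "X \<in> ?V"
    then obtain D where X: "X = void_event D" and D: "D \<in> sets borel" "bounded D" by auto
    have "X = {N \<in> configs. card (N \<inter> D) = 0}"
      using finite_config_Int[OF _ D(2)] by (auto simp: X void_event_def)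
    then show "X \<in> sigma_sets configs ?K" using D by (intro sigma_sets.Basic) blast
  qed
  then have "sigma_sets configs ?V \<subseteq> sigma_sets configs ?K"
    by (rule sigma_sets_mono)
  ultimately show ?thesis using c M by auto
qed

lemma sets_card_config [measurable]:
  "B \<in> sets borel \<Longrightarrow> bounded B \<Longrightarrow> {N \<in> configs. card (N \<inter> B) = k} \<in> sets config_space"
  unfolding config_space_def by (subst sets_measure_of) (auto intro!: sigma_sets.Basic)

lemma sets_void_event: "D \<in> sets borel \<Longrightarrow> bounded D \<Longrightarrow> void_event D \<in> sets config_space"
  unfolding sets_config_space_void by (intro sigma_sets.Basic) auto

text \<open>Void events generate the sigma-algebra, so a random configuration is measurable as soon
  as its emptiness on each bounded Borel set is an event. Insertion of a point and shifting are both
  handled this way.\<close>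

lemma measurable_configI:
  assumes "\<And>x. x \<in> space M \<Longrightarrow> T x \<in> configs"
    and "\<And>D. D \<in> sets borel \<Longrightarrow> bounded D \<Longrightarrow> {x \<in> space M. T x \<inter> D = {}} \<in> sets M"
  shows "T \<in> measurable M config_space"
proof (rule measurable_sigma_sets[OF sets_config_space_void])
  show "{void_event D |D. D \<in> sets borel \<and> bounded D} \<subseteq> Pow configs"
    by (auto simp: void_event_def)
  show "T \<in> space M \<rightarrow> configs" using assms(1) by auto
  fix X assume "X \<in> {void_event D |D. D \<in> sets borel \<and> bounded D}"
  then obtain D where X: "X = void_event D" and D: "D \<in> sets borel" "bounded D" by auto
  have "T -` X \<inter> space M = {x \<in> space M. T x \<inter> D = {}}"
    using assms(1) by (auto simp: X void_event_def)
  then show "T -` X \<inter> space M \<in> sets M" using assms(2)[OF D] by simp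
qed

section \<open>Measurability of sums over a random configuration\<close>

lemma borel_measurable_emeasure_config:
  assumes T: "T \<in> measurable M config_space" and B: "B \<in> sets borel" "bounded B"
  shows "(\<lambda>x. emeasure (count_space UNIV) (T x \<inter> B)) \<in> borel_measurable M"
proof -
  have conf: "T x \<in> configs" if "x \<in> space M" for x
    using measurable_space[OF T that] by simp
  have "(\<lambda>x. card (T x \<inter> B)) \<in> measurable M (count_space UNIV)"
  proof (rule measurable_compose[OF T])
    have "(\<lambda>N. card (N \<inter> B)) -` {k} \<inter> space config_space = {N \<in> configs. card (N \<inter> B) = k}" for k
      by auto
    then show "(\<lambda>N. card (N \<inter> B)) \<in> measurable config_space (count_space UNIV)"
      using sets_card_config[OF B] by (subst measurable_count_space_eq2_countable) auto
  qed
  then have "(\<lambda>x. of_nat (card (T x \<inter> B)) :: ennreal) \<in> borel_measurable M"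
    by measurable
  then show ?thesis
    by (rule measurable_cong[THEN iffD1, rotated])
      (simp add: emeasure_count_space_finite finite_config_Int conf B)
qed

text \<open>A Dynkin argument from rectangles, where the counted set is either empty or the part of
  \<open>T x\<close> in a fixed bounded Borel set. The window \<open>B\<close> keeps every count
  finite, without which the complement case could not subtract.\<close>

lemma borel_measurable_config_section:
  assumes T: "T \<in> measurable M config_space" and B: "B \<in> sets borel" "bounded B"
    and A: "A \<in> sets (borel \<Otimes>\<^sub>M M)"
  shows "(\<lambda>x. emeasure (count_space UNIV) {p \<in> T x \<inter> B. (p, x) \<in> A}) \<in> borel_measurable M"
  using Int_stable_pair_measure_generator pair_measure_closed A unfolding sets_pair_measure
proof (induct rule: sigma_sets_induct_disjoint)
  case (basic A)
  then obtain a b where A: "A = a \<times> b" and ab: "a \<in> sets borel" "b \<in> sets M" by auto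
  have "(\<lambda>x. emeasure (count_space UNIV) (T x \<inter> (B \<inter> a)) * indicator b x) \<in> borel_measurable M"
    using ab B by (intro borel_measurable_times_ennreal borel_measurable_emeasure_config[OF T]
      borel_measurable_indicator) (auto intro: bounded_subset)
  also have "(\<lambda>x. emeasure (count_space UNIV) (T x \<inter> (B \<inter> a)) * indicator b x) =
      (\<lambda>x. emeasure (count_space UNIV) {p \<in> T x \<inter> B. (p, x) \<in> A})"
    by (auto simp: A fun_eq_iff indicator_def intro!: arg_cong[where f="emeasure (count_space UNIV)"])
  finally show ?case .
next
  case empty
  show ?case by simp
next
  case (compl A)
  have "(\<lambda>x. emeasure (count_space UNIV) (T x \<inter> B) - emeasure (count_space UNIV) {p \<in> T x \<inter> B. (p, x) \<in> A})
      \<in> borel_measurable M"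
    by (intro borel_measurable_minus_ennreal borel_measurable_emeasure_config[OF T B] compl)
  then show ?case
  proof (rule measurable_cong[THEN iffD1, rotated])
    fix x assume x: "x \<in> space M"
    have fin: "finite (T x \<inter> B)"
      using measurable_space[OF T x] B by (auto intro: finite_config_Int)
    have "emeasure (count_space UNIV) (T x \<inter> B) - emeasure (count_space UNIV) {p \<in> T x \<inter> B. (p, x) \<in> A}
      = emeasure (count_space UNIV) ((T x \<inter> B) - {p \<in> T x \<inter> B. (p, x) \<in> A})"
    proof (rule emeasure_Diff[symmetric])
      have "finite {p \<in> T x \<inter> B. (p, x) \<in> A}"
        by (rule finite_subset[OF _ fin]) auto
      then show "emeasure (count_space UNIV) {p \<in> T x \<inter> B. (p, x) \<in> A} \<noteq> \<infinity>"
        by simp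
    qed auto
    also have "(T x \<inter> B) - {p \<in> T x \<inter> B. (p, x) \<in> A} = {p \<in> T x \<inter> B. (p, x) \<in> space borel \<times> space M - A}"
      using x by auto
    finally show "emeasure (count_space UNIV) (T x \<inter> B) - emeasure (count_space UNIV) {p \<in> T x \<inter> B. (p, x) \<in> A}
      = emeasure (count_space UNIV) {p \<in> T x \<inter> B. (p, x) \<in> space borel \<times> space M - A}" .
  qed
next
  case (union A)
  have "(\<lambda>x. \<Sum>i. emeasure (count_space UNIV) {p \<in> T x \<inter> B. (p, x) \<in> A i}) \<in> borel_measurable M"
    using union(3) by (intro borel_measurable_suminf_order)
  also have "(\<lambda>x. \<Sum>i. emeasure (count_space UNIV) {p \<in> T x \<inter> B. (p, x) \<in> A i}) =
      (\<lambda>x. emeasure (count_space UNIV) {p \<in> T x \<inter> B. (p, x) \<in> (\<Union>i. A i)})"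
  proof
    fix x
    have "(\<Sum>i. emeasure (count_space UNIV) {p \<in> T x \<inter> B. (p, x) \<in> A i}) =
      emeasure (count_space UNIV) (\<Union>i. {p \<in> T x \<inter> B. (p, x) \<in> A i})"
      using union(1) by (intro suminf_emeasure) (auto simp: disjoint_family_on_def)
    also have "(\<Union>i. {p \<in> T x \<inter> B. (p, x) \<in> A i}) = {p \<in> T x \<inter> B. (p, x) \<in> (\<Union>i. A i)}"
      by auto
    finally show "(\<Sum>i. emeasure (count_space UNIV) {p \<in> T x \<inter> B. (p, x) \<in> A i}) =
      emeasure (count_space UNIV) {p \<in> T x \<inter> B. (p, x) \<in> (\<Union>i. A i)}" .
  qed
  finally show ?case .
qed

lemma nn_integral_count_space_section_SUP:
  fixes X :: "(real \<times> real) set"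
  shows "(\<integral>\<^sup>+p. indicator A (p, x) \<partial>count_space X) =
    (SUP n. emeasure (count_space UNIV) {p \<in> X \<inter> cball 0 (real n). (p, x) \<in> A})"
proof -
  have "(\<integral>\<^sup>+p. indicator A (p, x) \<partial>count_space X) = (\<integral>\<^sup>+p. indicator {p \<in> X. (p, x) \<in> A} p \<partial>count_space UNIV)"
    by (subst nn_integral_count_space_indicator, simp, intro nn_integral_cong) (auto split: split_indicator)
  also have "\<dots> = emeasure (count_space UNIV) {p \<in> X. (p, x) \<in> A}"
    by (rule nn_integral_indicator) simp
  also have "{p \<in> X. (p, x) \<in> A} = (\<Union>n. {p \<in> X \<inter> cball 0 (real n). (p, x) \<in> A})"
    by (auto intro: real_arch_simple)
  also have "emeasure (count_space UNIV) \<dots> = (SUP n. emeasure (count_space UNIV) {p \<in> X \<inter> cball 0 (real n). (p, x) \<in> A})"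
    by (rule SUP_emeasure_incseq[symmetric]) (auto simp: incseq_def)
  finally show ?thesis .
qed

text \<open>Letting the summand depend on \<open>x\<close> as well as on the point covers summands
  that look at the whole configuration, as in the Mecke formula. Indicators are reduced to bounded
  windows by exhausting the plane with balls; the rest is induction over nonnegative measurable
  functions.\<close>

lemma borel_measurable_config_sum:
  assumes T: "T \<in> measurable M config_space" and G: "G \<in> borel_measurable (borel \<Otimes>\<^sub>M M)"
  shows "(\<lambda>x. \<integral>\<^sup>+p. G (p, x) \<partial>count_space (T x)) \<in> borel_measurable M"
  using G
proof (induct rule: borel_measurable_induct)
  case (cong f g)
  show ?case
  proof (rule measurable_cong[THEN iffD1, OF _ cong(4)])
    fix x assume "x \<in> space M"
    then show "(\<integral>\<^sup>+p. g (p, x) \<partial>count_space (T x)) = (\<integral>\<^sup>+p. f (p, x) \<partial>count_space (T x))"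
      by (intro nn_integral_cong cong(3)[symmetric]) (auto simp: space_pair_measure)
  qed
next
  case (set A)
  have "(\<lambda>x. SUP n::nat. emeasure (count_space UNIV) {p \<in> T x \<inter> cball 0 (real n). (p, x) \<in> A}) \<in> borel_measurable M"
    by (intro borel_measurable_SUP borel_measurable_config_section[OF T _ _ set]) auto
  then show ?case by (simp add: nn_integral_count_space_section_SUP)
next
  case (mult u c)
  then show ?case by (simp add: nn_integral_cmult)
next
  case (add u v)
  then show ?case by (simp add: nn_integral_add)
next
  case (seq U)
  have "(\<lambda>x. SUP i. \<integral>\<^sup>+p. U i (p, x) \<partial>count_space (T x)) \<in> borel_measurable M"
    by (intro borel_measurable_SUP seq) auto
  also have "(\<lambda>x. SUP i. \<integral>\<^sup>+p. U i (p, x) \<partial>count_space (T x)) =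
    (\<lambda>x. \<integral>\<^sup>+p. (SUP i. U i) (p, x) \<partial>count_space (T x))"
  proof
    fix x
    show "(SUP i. \<integral>\<^sup>+p. U i (p, x) \<partial>count_space (T x)) = (\<integral>\<^sup>+p. (SUP i. U i) (p, x) \<partial>count_space (T x))"
      unfolding SUP_apply using seq(4)
      by (intro nn_integral_monotone_convergence_SUP[symmetric]) (auto simp: incseq_def le_fun_def)
  qed
  finally show ?case .
qed

text \<open>A universal quantifier over random points is not a countable intersection of events. It
  says, however, that the number of points of \<open>T x\<close> falling into the section of
  \<open>A\<close> vanishes, and that number is measurable in \<open>x\<close>.\<close>

lemma sets_config_disjoint:
  assumes T: "T \<in> measurable M config_space" and A: "A \<in> sets (borel \<Otimes>\<^sub>M M)"
  shows "{x \<in> space M. \<forall>p\<in>T x. (p, x) \<notin> A} \<in> sets M"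
proof -
  have "(\<lambda>x. \<integral>\<^sup>+p. indicator A (p, x) \<partial>count_space (T x)) \<in> borel_measurable M"
    using A by (intro borel_measurable_config_sum[OF T, where G = "indicator A"] borel_measurable_indicator)
  then have "{x \<in> space M. (\<integral>\<^sup>+p. indicator A (p, x) \<partial>count_space (T x)) = 0} \<in> sets M"
    by measurable
  also have "{x \<in> space M. (\<integral>\<^sup>+p. indicator A (p, x) \<partial>count_space (T x)) = 0} =
      {x \<in> space M. \<forall>p\<in>T x. (p, x) \<notin> A}"
    by (subst nn_integral_0_iff_AE) (auto simp: AE_count_space indicator_eq_0_iff)
  finally show ?thesis .
qed

text \<open>The intersection with \<open>Hplus\<close> keeps \<open>ins p N\<close> a configuration even when \<open>p\<close> lies outside the
  half-plane, which makes \<open>ins\<close> jointly measurable on the whole plane.\<close>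

definition ins :: "real \<times> real \<Rightarrow> (real \<times> real) set \<Rightarrow> (real \<times> real) set" where
  "ins p N = insert p N \<inter> Hplus"

lemma sets_Hplus [measurable]: "Hplus \<in> sets borel"
proof -
  have "Hplus = {p. snd p > 0}" by (auto simp: Hplus_def)
  also have "\<dots> \<in> sets borel" by measurable
  finally show ?thesis .
qed

lemma configs_subset_Hplus: "N \<in> configs \<Longrightarrow> N \<subseteq> Hplus"
  by (simp add: configs_def)

lemma ins_eq_insert: "N \<in> configs \<Longrightarrow> p \<in> Hplus \<Longrightarrow> ins p N = insert p N"
  using configs_subset_Hplus by (auto simp: ins_def)

lemma ins_in_configs: "N \<in> configs \<Longrightarrow> ins p N \<in> configs"
proof -
  assume N: "N \<in> configs"
  have "finite (ins p N \<inter> B)" if "bounded B" for B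
    using finite_config_Int[OF N that]
    by (rule finite_subset[of _ "insert p (N \<inter> B)", rotated, OF finite.insertI]) (auto simp: ins_def)
  then show ?thesis by (auto simp: configs_def ins_def)
qed

lemma shift_in_configs:
  assumes "N \<in> configs"
  shows "shift s N \<in> configs"
proof -
  have "finite (shift s N \<inter> B)" if B: "bounded B" for B
  proof -
    have "bounded ((\<lambda>p. (s, 0) + p) ` B)" using B by (rule bounded_translation)
    then have "finite (shift s (N \<inter> (\<lambda>p. (s, 0) + p) ` B))"
      unfolding shift_def using assms by (intro finite_imageI finite_config_Int)
    moreover have "shift s N \<inter> B \<subseteq> shift s (N \<inter> (\<lambda>p. (s, 0) + p) ` B)"
      by (force simp: shift_def image_iff)
    ultimately show ?thesis by (rule rev_finite_subset)
  qed
  moreover have "shift s N \<subseteq> Hplus"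
    using configs_subset_Hplus[OF assms] by (auto simp: shift_def Hplus_def)
  ultimately show ?thesis by (simp add: configs_def)
qed

lemma shift_eq_image: "shift s N = (\<lambda>p. (fst p - s, snd p)) ` N"
  by (auto simp: shift_def case_prod_beta)

lemma shift_disjoint_iff: "shift s N \<inter> D = {} \<longleftrightarrow> (\<forall>p\<in>N. (fst p - s, snd p) \<notin> D)"
  unfolding shift_eq_image by blast

lemma measurable_ins [measurable (raw)]:
  assumes p [measurable]: "p \<in> borel_measurable M" and T [measurable]: "T \<in> measurable M config_space"
  shows "(\<lambda>x. ins (p x) (T x)) \<in> measurable M config_space"
proof (rule measurable_configI)
  fix x assume "x \<in> space M"
  then show "ins (p x) (T x) \<in> configs"
    using measurable_space[OF T] by (auto intro: ins_in_configs)
next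
  fix D :: "(real \<times> real) set" assume D [measurable]: "D \<in> sets borel" and "bounded D"
  have *: "{x \<in> space M. \<forall>q\<in>T x. (q, x) \<notin> (D \<inter> Hplus) \<times> space M} \<in> sets M"
    by (rule sets_config_disjoint[OF T]) simp
  have "{x \<in> space M. ins (p x) (T x) \<inter> D = {}} =
      {x \<in> space M. p x \<notin> D \<inter> Hplus} \<inter> {x \<in> space M. \<forall>q\<in>T x. (q, x) \<notin> (D \<inter> Hplus) \<times> space M}"
    by (auto simp: ins_def)
  also have "\<dots> \<in> sets M" using * by measurable
  finally show "{x \<in> space M. ins (p x) (T x) \<inter> D = {}} \<in> sets M" .
qed

lemma measurable_shift [measurable (raw)]:
  assumes s [measurable]: "s \<in> borel_measurable M" and T [measurable]: "T \<in> measurable M config_space"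
  shows "(\<lambda>x. shift (s x) (T x)) \<in> measurable M config_space"
proof (rule measurable_configI)
  fix x assume "x \<in> space M"
  then show "shift (s x) (T x) \<in> configs"
    using measurable_space[OF T] by (auto intro: shift_in_configs)
next
  fix D :: "(real \<times> real) set" assume D [measurable]: "D \<in> sets borel" and "bounded D"
  let ?A = "{z \<in> space (borel \<Otimes>\<^sub>M M). (fst (fst z) - s (snd z), snd (fst z)) \<in> D}"
  have "(\<lambda>z. (fst (fst z) - s (snd z), snd (fst z)))
      \<in> borel_measurable ((borel :: (real \<times> real) measure) \<Otimes>\<^sub>M M)"
    by (intro borel_measurable_Pair borel_measurable_diff measurable_compose[OF measurable_fst borel_measurable_fst_borel]
      measurable_compose[OF measurable_fst borel_measurable_snd_borel] measurable_compose[OF measurable_snd s])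
  then have "?A \<in> sets (borel \<Otimes>\<^sub>M M)" by measurable
  from sets_config_disjoint[OF T this]
  show "{x \<in> space M. shift (s x) (T x) \<inter> D = {}} \<in> sets M"
    by (rule back_subst[where P = "\<lambda>X. X \<in> sets M"])
      (auto simp: shift_disjoint_iff space_pair_measure)
qed

section \<open>Mecke formula and stationarity\<close>

text \<open>The law prescribes counts only for subsets of \<open>Hplus\<close>. Cutting with
  \<open>Hplus\<close> here allows arbitrary bounded Borel sets afterwards, because a configuration
  has no points elsewhere.\<close>

definition area :: "(real \<times> real) set \<Rightarrow> real" where
  "area B = measure lborel (B \<inter> Hplus)"

lemma area_nonneg [simp]: "area B \<ge> 0"
  by (simp add: area_def)

lemma emeasure_area:
  assumes "bounded B" "B \<in> sets borel"
  shows "emeasure lborel (B \<inter> Hplus) = ennreal (area B)"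
proof -
  have "emeasure lborel (B \<inter> Hplus) < \<infinity>"
    using assms by (intro emeasure_bounded_finite) (auto intro: bounded_subset)
  then show ?thesis unfolding area_def by (intro emeasure_eq_ennreal_measure) auto
qed

lemma poisson_first_moment_sums:
  fixes b :: real
  shows "(\<lambda>k. real k * (exp (- b) * b ^ k / fact k)) sums b"
proof -
  have "(\<lambda>k. b ^ k / fact k) sums exp b"
    using exp_converges[of b] by (simp add: field_simps)
  then have "(\<lambda>k. (exp (- b) * b) * (b ^ k / fact k)) sums ((exp (- b) * b) * exp b)"
    by (rule sums_mult)
  also have "(exp (- b) * b) * exp b = b"
    by (simp add: exp_minus)
  also have "(\<lambda>k. (exp (- b) * b) * (b ^ k / fact k)) = (\<lambda>k. real (Suc k) * (exp (- b) * b ^ Suc k / fact (Suc k)))"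
    by (auto simp: field_simps simp del: of_nat_Suc)
  finally show ?thesis
    \<comment> \<open>The term for k = 0 vanishes, so the shift of the index loses nothing.\<close>
    by (subst (asm) sums_Suc_iff) simp
qed

locale poisson_heads =
  fixes lam :: real and P :: "(real \<times> real) set measure"
  assumes lam_pos: "lam > 0" and law: "poisson_head_law lam P"

sublocale poisson_heads \<subseteq> prob_space P
  using law by (simp add: poisson_head_law_def)

context poisson_heads
begin

lemma sets_P [simp, measurable_cong]: "sets P = sets config_space"
  using law by (simp add: poisson_head_law_def)

lemma space_P [simp]: "space P = configs"
  using sets_eq_imp_space_eq[OF sets_P] by simp

text \<open>The finite-dimensional distributions enter the proof only through this case of two
  disjoint sets: one set to count in, the other to be empty.\<close>

lemma prob_two_counts:
  assumes "B \<in> sets borel" "bounded B" "D \<in> sets borel" "bounded D" "B \<inter> D = {}"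
  shows "prob {N \<in> configs. card (N \<inter> B) = k \<and> card (N \<inter> D) = l} =
    (exp (- (2 * lam * area B)) * (2 * lam * area B) ^ k / fact k) *
    (exp (- (2 * lam * area D)) * (2 * lam * area D) ^ l / fact l)"
proof -
  let ?F = "\<lambda>i::nat. if i = 0 then B \<inter> Hplus else D \<inter> Hplus"
  let ?k = "\<lambda>i::nat. if i = 0 then k else l"
  have lt2: "(\<forall>i<2. Q i) \<longleftrightarrow> Q 0 \<and> Q 1" for Q :: "nat \<Rightarrow> bool"
    by (auto simp: less_Suc_eq numeral_2_eq_2)
  have "(\<forall>i<2. ?F i \<in> sets borel \<and> bounded (?F i) \<and> ?F i \<subseteq> Hplus) \<and> disjoint_family_on ?F {..<2}"
    using assms by (auto simp: lt2 disjoint_family_on_def intro: bounded_subset)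
  from law[unfolded poisson_head_law_def, THEN conjunct2, THEN conjunct2, rule_format, OF this, of ?k]
  have "measure P {N \<in> space P. \<forall>i<2. card (N \<inter> ?F i) = ?k i}
            = (\<Prod>i<2. exp (- (2 * lam * measure lborel (?F i)))
                        * (2 * lam * measure lborel (?F i)) ^ ?k i / fact (?k i))"
    .
  moreover have "{N \<in> space P. \<forall>i<2. card (N \<inter> ?F i) = ?k i} =
      {N \<in> configs. card (N \<inter> B) = k \<and> card (N \<inter> D) = l}"
  proof -
    have "N \<inter> (X \<inter> Hplus) = N \<inter> X" if "N \<in> configs" for N X
      using configs_subset_Hplus[OF that] by auto
    then show ?thesis unfolding lt2 by auto
  qed
  ultimately show ?thesis by (simp add: numeral_2_eq_2 area_def)
qed

lemma prob_void_event:
  assumes "D \<in> sets borel" "bounded D"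
  shows "prob (void_event D) = exp (- (2 * lam * area D))"
proof -
  have "prob {N \<in> configs. card (N \<inter> D) = 0 \<and> card (N \<inter> {}) = 0} = exp (- (2 * lam * area D))"
    using assms by (subst prob_two_counts) (auto simp: area_def)
  also have "{N \<in> configs. card (N \<inter> D) = 0 \<and> card (N \<inter> {}) = 0} = void_event D"
    using finite_config_Int[OF _ assms(2)] by (auto simp: void_event_def)
  finally show ?thesis .
qed

lemma emeasure_void_event:
  "D \<in> sets borel \<Longrightarrow> bounded D \<Longrightarrow> emeasure P (void_event D) = ennreal (exp (- (2 * lam * area D)))"
  by (simp add: emeasure_eq_measure prob_void_event)

text \<open>When \<open>D\<close> is empty, all points counted in \<open>B\<close> lie in
  \<open>B - D\<close>, and the count there is independent of what happens in \<open>D\<close>. The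
  expectation is thus a Poisson mean times a void probability, even if \<open>B\<close> and
  \<open>D\<close> overlap.\<close>

lemma nn_integral_count_void:
  assumes B: "B \<in> sets borel" "bounded B" and D: "D \<in> sets borel" "bounded D"
  shows "(\<integral>\<^sup>+N. emeasure (count_space UNIV) (N \<inter> B) * indicator (void_event D) N \<partial>P) =
    ennreal (2 * lam * area (B - D) * exp (- (2 * lam * area D)))"
proof -
  \<comment> \<open>These events split \<open>void_event D\<close> according to the number of points
    in \<open>B - D\<close>, which on that event is the number of points in
    \<open>B\<close>.\<close>
  define X where "X k = {N \<in> configs. card (N \<inter> (B - D)) = k \<and> card (N \<inter> D) = 0}" for k
  have BD: "B - D \<in> sets borel" "bounded (B - D)" "(B - D) \<inter> D = {}"
    using B D by (auto intro: bounded_subset)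
  have X_sets: "X k \<in> sets config_space" for k
  proof -
    have "X k = {N \<in> configs. card (N \<inter> (B - D)) = k} \<inter> {N \<in> configs. card (N \<inter> D) = 0}"
      by (auto simp: X_def)
    then show ?thesis using sets_card_config BD D by auto
  qed
  have "(\<integral>\<^sup>+N. emeasure (count_space UNIV) (N \<inter> B) * indicator (void_event D) N \<partial>P) =
      (\<integral>\<^sup>+N. (\<Sum>k. of_nat k * indicator (X k) N) \<partial>P)"
  proof (intro nn_integral_cong)
    fix N assume "N \<in> space P"
    then have N: "N \<in> configs" by simp
    note fin = finite_config_Int[OF N]
    show "emeasure (count_space UNIV) (N \<inter> B) * indicator (void_event D) N = (\<Sum>k. of_nat k * indicator (X k) N)"
    proof (cases "N \<inter> D = {}")
      case True
      then have eq: "N \<inter> (B - D) = N \<inter> B" by auto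
      have "(\<Sum>k. of_nat k * indicator (X k) N) = (\<Sum>k\<in>{card (N \<inter> B)}. of_nat k * indicator (X k) N :: ennreal)"
        using True by (intro suminf_finite) (auto simp: X_def eq)
      then show ?thesis
        using True N fin[OF B(2)] by (simp add: void_event_def X_def eq)
    next
      case False
      then have "card (N \<inter> D) \<noteq> 0" using fin[OF D(2)] by simp
      then show ?thesis using False by (simp add: void_event_def X_def)
    qed
  qed
  also have "\<dots> = (\<Sum>k. \<integral>\<^sup>+N. of_nat k * indicator (X k) N \<partial>P)"
    using X_sets by (intro nn_integral_suminf) auto
  also have "\<dots> = (\<Sum>k. ennreal (real k * prob (X k)))"
    using X_sets by (simp add: nn_integral_cmult emeasure_eq_measure ennreal_mult ennreal_of_nat_eq_real_of_nat)
  also have "\<dots> = ennreal (2 * lam * area (B - D) * exp (- (2 * lam * area D)))"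
  proof (rule suminf_ennreal_eq)
    show "0 \<le> real k * prob (X k)" for k by simp
    have "prob (X k) = (exp (- (2 * lam * area (B - D))) * (2 * lam * area (B - D)) ^ k / fact k) * exp (- (2 * lam * area D))" for k
      unfolding X_def using BD D by (subst prob_two_counts) auto
    then show "(\<lambda>k. real k * prob (X k)) sums (2 * lam * area (B - D) * exp (- (2 * lam * area D)))"
      using sums_mult2[OF poisson_first_moment_sums, of "2 * lam * area (B - D)" "exp (- (2 * lam * area D))"]
      by (simp add: mult.assoc)
  qed
  finally show ?thesis .
qed

end

section \<open>The generating rectangles and the Mecke formula\<close>

lemma sets_borel_pair_config_space:
  "sets ((borel :: (real \<times> real) measure) \<Otimes>\<^sub>M config_space) =
    sigma_sets (UNIV \<times> configs) {a \<times> void_event D |a D. a \<in> sets borel \<and> D \<in> sets borel \<and> bounded D}"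
proof -
  let ?V = "{void_event D |D. D \<in> sets borel \<and> bounded D}"
  have "sets ((borel :: (real \<times> real) measure) \<Otimes>\<^sub>M config_space) =
      sets (sigma (space (borel :: (real \<times> real) measure) \<times> space config_space)
        {a \<times> b |a b. a \<in> sets borel \<and> b \<in> ?V})"
  proof (rule sets_pair_eq[where Ca = "{UNIV}" and Cb = "{void_event {}}"])
    show "sets (borel :: (real \<times> real) measure) = sigma_sets (space borel) (sets borel)"
      by (rule sets.sigma_sets_eq[symmetric])
    show "sets config_space = sigma_sets (space config_space) ?V"
      by (simp add: sets_config_space_void)
  qed (auto simp: void_event_def intro!: exI[of _ "{}"])
  also have "{a \<times> b |a b. a \<in> sets borel \<and> b \<in> ?V} =
      {a \<times> void_event D |a D. a \<in> sets (borel :: (real \<times> real) measure) \<and> D \<in> sets borel \<and> bounded D}"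
    by blast
  finally show ?thesis
    by (subst (asm) sets_measure_of) (auto simp: void_event_def)
qed

lemma Int_stable_void_rectangles:
  "Int_stable {a \<times> void_event D |a D. a \<in> sets (borel :: (real \<times> real) measure) \<and> D \<in> sets borel \<and> bounded D}"
proof (rule Int_stableI)
  fix X Y :: "((real \<times> real) \<times> (real \<times> real) set) set"
  assume "X \<in> {a \<times> void_event D |a D. a \<in> sets borel \<and> D \<in> sets borel \<and> bounded D}"
    and "Y \<in> {a \<times> void_event D |a D. a \<in> sets borel \<and> D \<in> sets borel \<and> bounded D}"
  then obtain a D b E where *: "X = a \<times> void_event D" "Y = b \<times> void_event E"
    "a \<in> sets borel" "D \<in> sets borel" "bounded D" "b \<in> sets borel" "E \<in> sets borel" "bounded E"
    by auto
  have "X \<inter> Y = (a \<inter> b) \<times> void_event (D \<union> E)"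
    by (auto simp: * void_event_def)
  moreover have "a \<inter> b \<in> sets borel" "D \<union> E \<in> sets borel" "bounded (D \<union> E)" using * by auto
  ultimately show "X \<inter> Y \<in> {a \<times> void_event D |a D. a \<in> sets borel \<and> D \<in> sets borel \<and> bounded D}"
    by blast
qed

lemma Int_stable_void_events: "Int_stable {void_event D |D. D \<in> sets borel \<and> bounded D}"
proof (rule Int_stableI)
  fix X Y
  assume "X \<in> {void_event D |D. D \<in> sets borel \<and> bounded D}"
    and "Y \<in> {void_event D |D. D \<in> sets borel \<and> bounded D}"
  then obtain D E where *: "X = void_event D" "Y = void_event E"
    "D \<in> sets borel" "bounded D" "E \<in> sets borel" "bounded E"
    by auto
  have "X \<inter> Y = void_event (D \<union> E)"
    by (auto simp: * void_event_def)
  moreover have "D \<union> E \<in> sets borel" "bounded (D \<union> E)" using * by auto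
  ultimately show "X \<inter> Y \<in> {void_event D |D. D \<in> sets borel \<and> bounded D}"
    by blast
qed

context poisson_heads
begin

lemma sets_borel_pair_P [measurable_cong]: "sets (borel \<Otimes>\<^sub>M P) = sets (borel \<Otimes>\<^sub>M config_space)"
  by (intro sets_pair_measure_cong) simp_all

text \<open>On a rectangle \<open>a \<times> void_event D\<close> both sides equal 2 lam area(B
  \<inter> a - D) exp(- 2 lam area(D)): the left one by the first moment on a void event, the right
  one because for \<open>p\<close> in \<open>Hplus\<close> the set \<open>ins p N\<close> misses
  \<open>D\<close> exactly if \<open>p\<close> and \<open>N\<close> both do. The Dynkin argument
  extends this, with \<open>B\<close> bounded so that the total mass is finite.\<close>

lemma mecke_set_bounded:
  assumes B [measurable]: "B \<in> sets borel" "bounded B"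
    and A: "A \<in> sets (borel \<Otimes>\<^sub>M config_space)"
  shows "(\<integral>\<^sup>+N. emeasure (count_space UNIV) {p \<in> N \<inter> B. (p, N) \<in> A} \<partial>P) =
    (\<integral>\<^sup>+p. ennreal (2 * lam) * indicator (B \<inter> Hplus) p * (\<integral>\<^sup>+N. indicator A (p, ins p N) \<partial>P) \<partial>lborel)"
    (is "?L A = ?R A")
proof -
  note sec = borel_measurable_config_section[OF measurable_ident_sets[OF sets_P] B, unfolded sets_borel_pair_P]
  have cl: "{a \<times> void_event D |a D. a \<in> sets (borel :: (real \<times> real) measure) \<and> D \<in> sets borel \<and> bounded D}
      \<subseteq> Pow (UNIV \<times> configs)"
    by (auto simp: void_event_def)
  have rectangle: "?L (a \<times> void_event D) = ?R (a \<times> void_event D)"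
    if [measurable]: "a \<in> sets borel" and D [measurable]: "D \<in> sets borel" "bounded D" for a D
  proof -
    have bd: "bounded (B \<inter> a)" "bounded (B \<inter> a - D)" using B by (auto intro: bounded_subset)
    have "?L (a \<times> void_event D) =
        (\<integral>\<^sup>+N. emeasure (count_space UNIV) (N \<inter> (B \<inter> a)) * indicator (void_event D) N \<partial>P)"
      by (intro nn_integral_cong)
        (auto split: split_indicator intro!: arg_cong[where f = "emeasure (count_space UNIV)"])
    also have "\<dots> = ennreal (2 * lam * area (B \<inter> a - D) * exp (- (2 * lam * area D)))"
      using D bd by (intro nn_integral_count_void) auto
    also have "\<dots> = ennreal (2 * lam) * emeasure P (void_event D) * emeasure lborel ((B \<inter> a - D) \<inter> Hplus)"
      using D bd lam_pos by (simp add: emeasure_void_event emeasure_area ennreal_mult mult_ac)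
    also have "\<dots> = (\<integral>\<^sup>+p. ennreal (2 * lam) * emeasure P (void_event D) * indicator ((B \<inter> a - D) \<inter> Hplus) p \<partial>lborel)"
      by (subst nn_integral_cmult_indicator) auto
    also have "\<dots> = ?R (a \<times> void_event D)"
    proof (intro nn_integral_cong)
      fix p :: "real \<times> real"
      have "(\<integral>\<^sup>+N. indicator (a \<times> void_event D) (p, ins p N) \<partial>P) =
          (\<integral>\<^sup>+N. indicator (a - D) p * indicator (void_event D) N \<partial>P)" if "p \<in> Hplus"
      proof (intro nn_integral_cong)
        fix N assume N: "N \<in> space P"
        then have "ins p N \<inter> D = {} \<longleftrightarrow> p \<notin> D \<and> N \<inter> D = {}"
          using that by (auto simp: ins_eq_insert)
        then show "indicator (a \<times> void_event D) (p, ins p N) = (indicator (a - D) p * indicator (void_event D) N :: ennreal)"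
          using N by (auto split: split_indicator simp: ins_in_configs void_event_def)
      qed
      also have "\<dots> = indicator (a - D) p * emeasure P (void_event D)"
        using sets_void_event[OF D] by (simp add: nn_integral_cmult)
      finally show "ennreal (2 * lam) * emeasure P (void_event D) * indicator ((B \<inter> a - D) \<inter> Hplus) p =
          ennreal (2 * lam) * indicator (B \<inter> Hplus) p * (\<integral>\<^sup>+N. indicator (a \<times> void_event D) (p, ins p N) \<partial>P)"
        by (auto split: split_indicator)
    qed
    finally show ?thesis .
  qed
  have total: "?L (UNIV \<times> configs) = ?R (UNIV \<times> configs)"
    using rectangle[of UNIV "{}"] by (simp add: void_event_def)
  have fin: "?L (UNIV \<times> configs) \<noteq> \<infinity>"
  proof -
    have "?L (UNIV \<times> configs) = (\<integral>\<^sup>+N. emeasure (count_space UNIV) (N \<inter> B) * indicator (void_event {}) N \<partial>P)"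
      by (intro nn_integral_cong)
        (auto simp: void_event_def intro!: arg_cong[where f = "emeasure (count_space UNIV)"])
    then show ?thesis
      using nn_integral_count_void[OF B, of "{}"] by simp
  qed
  have inner: "(\<lambda>p. \<integral>\<^sup>+N. indicator A (p, ins p N) \<partial>P) \<in> borel_measurable borel"
    if [measurable]: "A \<in> sets (borel \<Otimes>\<^sub>M config_space)" for A
    by measurable
  have innerR: "(\<lambda>p. ennreal (2 * lam) * indicator (C \<inter> Hplus) p * (\<integral>\<^sup>+N. indicator A (p, ins p N) \<partial>P)) \<in> borel_measurable lborel"
    if "A \<in> sets (borel \<Otimes>\<^sub>M config_space)" and "C \<in> sets borel" for A C
    using inner[OF that(1)] that(2)
    by (auto intro!: borel_measurable_times_ennreal borel_measurable_indicator)
  have innerN: "(\<lambda>N. indicator A (p, ins p N) :: ennreal) \<in> borel_measurable P"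
    if [measurable]: "A \<in> sets (borel \<Otimes>\<^sub>M config_space)" for A p
    by measurable
  show ?thesis
    using Int_stable_void_rectangles cl A[unfolded sets_borel_pair_config_space]
  proof (induct rule: sigma_sets_induct_disjoint)
    case (basic A)
    then show ?case using rectangle by blast
  next
    case empty
    show ?case by simp
  next
    case (compl A)
    then have A [measurable]: "A \<in> sets (borel \<Otimes>\<^sub>M config_space)"
      by (simp add: sets_borel_pair_config_space)
    have cA: "UNIV \<times> configs - A \<in> sets (borel \<Otimes>\<^sub>M config_space)"
      using sets.compl_sets[OF A] by (simp add: space_pair_measure)
    have "?L (UNIV \<times> configs) = (\<integral>\<^sup>+N. emeasure (count_space UNIV) {p \<in> N \<inter> B. (p, N) \<in> A}
        + emeasure (count_space UNIV) {p \<in> N \<inter> B. (p, N) \<in> UNIV \<times> configs - A} \<partial>P)"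
      by (intro nn_integral_cong, subst plus_emeasure)
        (auto intro!: arg_cong[where f = "emeasure (count_space UNIV)"])
    also have "\<dots> = ?L A + ?L (UNIV \<times> configs - A)"
      by (intro nn_integral_add sec A cA)
    finally have L: "?L (UNIV \<times> configs) = ?L A + ?L (UNIV \<times> configs - A)" .
    have "?R (UNIV \<times> configs) = (\<integral>\<^sup>+p. ennreal (2 * lam) * indicator (B \<inter> Hplus) p * (\<integral>\<^sup>+N. indicator A (p, ins p N) \<partial>P)
        + ennreal (2 * lam) * indicator (B \<inter> Hplus) p * (\<integral>\<^sup>+N. indicator (UNIV \<times> configs - A) (p, ins p N) \<partial>P) \<partial>lborel)"
    proof (intro nn_integral_cong)
      fix p :: "real \<times> real"
      have "(\<integral>\<^sup>+N. indicator (UNIV \<times> configs) (p, ins p N) \<partial>P) =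
          (\<integral>\<^sup>+N. indicator A (p, ins p N) + indicator (UNIV \<times> configs - A) (p, ins p N) \<partial>P)"
        by (intro nn_integral_cong) (auto split: split_indicator simp: ins_in_configs)
      also have "\<dots> = (\<integral>\<^sup>+N. indicator A (p, ins p N) \<partial>P) + (\<integral>\<^sup>+N. indicator (UNIV \<times> configs - A) (p, ins p N) \<partial>P)"
        by (intro nn_integral_add innerN A cA)
      finally show "ennreal (2 * lam) * indicator (B \<inter> Hplus) p * (\<integral>\<^sup>+N. indicator (UNIV \<times> configs) (p, ins p N) \<partial>P) =
        ennreal (2 * lam) * indicator (B \<inter> Hplus) p * (\<integral>\<^sup>+N. indicator A (p, ins p N) \<partial>P)
        + ennreal (2 * lam) * indicator (B \<inter> Hplus) p * (\<integral>\<^sup>+N. indicator (UNIV \<times> configs - A) (p, ins p N) \<partial>P)"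
        by (simp add: distrib_left)
    qed
    also have "\<dots> = ?R A + ?R (UNIV \<times> configs - A)"
      by (intro nn_integral_add innerR A cA B)
    finally have R: "?R (UNIV \<times> configs) = ?R A + ?R (UNIV \<times> configs - A)" .
    \<comment> \<open>Both sides split over \<open>A\<close> and its complement and agree on
      \<open>A\<close> by induction; cancelling that part is legitimate because the total mass in
      the bounded window is finite.\<close>
    have "?L A + ?L (UNIV \<times> configs - A) = ?L A + ?R (UNIV \<times> configs - A)"
      using L R total compl by simp
    moreover have "?L A \<noteq> \<infinity>" using L fin by auto
    ultimately show ?case
      by (simp add: ennreal_add_left_cancel)
  next
    case (union A)
    then have A: "A i \<in> sets (borel \<Otimes>\<^sub>M config_space)" for i
      by (auto simp: sets_borel_pair_config_space)
    have disj: "disjoint_family (\<lambda>i. {p \<in> N \<inter> B. (p, N) \<in> A i})" for N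
      using union(1) by (auto simp: disjoint_family_on_def)
    have "?L (\<Union>i. A i) = (\<integral>\<^sup>+N. (\<Sum>i. emeasure (count_space UNIV) {p \<in> N \<inter> B. (p, N) \<in> A i}) \<partial>P)"
      by (intro nn_integral_cong, subst suminf_emeasure[OF _ disj])
        (auto intro!: arg_cong[where f = "emeasure (count_space UNIV)"])
    also have "\<dots> = (\<Sum>i. ?L (A i))"
      by (intro nn_integral_suminf sec A)
    also have "\<dots> = (\<Sum>i. ?R (A i))"
      using union(3) by simp
    also have "\<dots> = (\<integral>\<^sup>+p. (\<Sum>i. ennreal (2 * lam) * indicator (B \<inter> Hplus) p * (\<integral>\<^sup>+N. indicator (A i) (p, ins p N) \<partial>P)) \<partial>lborel)"
      by (intro nn_integral_suminf[symmetric] innerR A B)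
    also have "\<dots> = ?R (\<Union>i. A i)"
    proof (intro nn_integral_cong)
      fix p :: "real \<times> real"
      have "(\<integral>\<^sup>+N. indicator (\<Union>i. A i) (p, ins p N) \<partial>P) = (\<integral>\<^sup>+N. (\<Sum>i. indicator (A i) (p, ins p N)) \<partial>P)"
        by (intro nn_integral_cong suminf_indicator[OF union(1), symmetric])
      also have "\<dots> = (\<Sum>i. \<integral>\<^sup>+N. indicator (A i) (p, ins p N) \<partial>P)"
        by (intro nn_integral_suminf innerN A)
      finally show "(\<Sum>i. ennreal (2 * lam) * indicator (B \<inter> Hplus) p * (\<integral>\<^sup>+N. indicator (A i) (p, ins p N) \<partial>P)) =
         ennreal (2 * lam) * indicator (B \<inter> Hplus) p * (\<integral>\<^sup>+N. indicator (\<Union>i. A i) (p, ins p N) \<partial>P)"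
        by simp
    qed
    finally show ?case .
  qed
qed

text \<open>The Mecke formula for intensity \<open>2 * lam\<close> on the half-plane. For an
  indicator, balls exhaust the plane and monotone convergence on both sides removes the bounded
  window; the other cases are the linear and monotone closure steps.\<close>

lemma mecke:
  assumes G: "G \<in> borel_measurable (borel \<Otimes>\<^sub>M config_space)"
  shows "(\<integral>\<^sup>+N. (\<integral>\<^sup>+p. G (p, N) \<partial>count_space N) \<partial>P) =
    (\<integral>\<^sup>+p. ennreal (2 * lam) * indicator Hplus p * (\<integral>\<^sup>+N. G (p, ins p N) \<partial>P) \<partial>lborel)"
proof -
  note sum = borel_measurable_config_sum[OF measurable_ident_sets[OF sets_P], unfolded sets_borel_pair_P measurable_cong_sets[OF sets_borel_pair_P refl]]
  have innerN: "(\<lambda>N. G (p, ins p N) :: ennreal) \<in> borel_measurable P"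
    if [measurable]: "G \<in> borel_measurable (borel \<Otimes>\<^sub>M config_space)" for G p
    by measurable
  have inner: "(\<lambda>p. \<integral>\<^sup>+N. G (p, ins p N) \<partial>P) \<in> borel_measurable borel"
    if [measurable]: "G \<in> borel_measurable (borel \<Otimes>\<^sub>M config_space)" for G
    by measurable
  have innerR: "(\<lambda>p. ennreal (2 * lam) * indicator (C \<inter> Hplus) p * (\<integral>\<^sup>+N. G (p, ins p N) \<partial>P)) \<in> borel_measurable lborel"
    if "G \<in> borel_measurable (borel \<Otimes>\<^sub>M config_space)" and "C \<in> sets borel" for G C
    using inner[OF that(1)] that(2)
    by (auto intro!: borel_measurable_times_ennreal borel_measurable_indicator)
  show ?thesis
    using G
  proof (induct rule: borel_measurable_induct)
    case (cong f g)
    have "(\<integral>\<^sup>+N. (\<integral>\<^sup>+p. f (p, N) \<partial>count_space N) \<partial>P) = (\<integral>\<^sup>+N. (\<integral>\<^sup>+p. g (p, N) \<partial>count_space N) \<partial>P)"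
      by (intro nn_integral_cong cong(3)) (auto simp: space_pair_measure)
    moreover have "(\<integral>\<^sup>+N. f (p, ins p N) \<partial>P) = (\<integral>\<^sup>+N. g (p, ins p N) \<partial>P)" for p
      by (intro nn_integral_cong cong(3)) (auto simp: space_pair_measure ins_in_configs)
    ultimately show ?case using cong(4) by simp
  next
    case (set A)
    note A [measurable] = set
    let ?B = "\<lambda>n. cball (0 :: real \<times> real) (real n)"
    have "(\<integral>\<^sup>+N. (\<integral>\<^sup>+p. indicator A (p, N) \<partial>count_space N) \<partial>P) =
        (\<integral>\<^sup>+N. (SUP n. emeasure (count_space UNIV) {p \<in> N \<inter> ?B n. (p, N) \<in> A}) \<partial>P)"
      by (simp add: nn_integral_count_space_section_SUP)
    also have "\<dots> = (SUP n. \<integral>\<^sup>+N. emeasure (count_space UNIV) {p \<in> N \<inter> ?B n. (p, N) \<in> A} \<partial>P)"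
    proof (rule nn_integral_monotone_convergence_SUP)
      show "incseq (\<lambda>n N. emeasure (count_space UNIV) {p \<in> N \<inter> ?B n. (p, N) \<in> A})"
        by (intro monoI le_funI emeasure_mono) auto
      show "(\<lambda>N. emeasure (count_space UNIV) {p \<in> N \<inter> ?B n. (p, N) \<in> A}) \<in> borel_measurable P" for n
        by (rule borel_measurable_config_section[OF measurable_ident_sets[OF sets_P]])
          (auto simp: sets_borel_pair_P)
    qed
    also have "\<dots> = (SUP n. \<integral>\<^sup>+p. ennreal (2 * lam) * indicator (?B n \<inter> Hplus) p * (\<integral>\<^sup>+N. indicator A (p, ins p N) \<partial>P) \<partial>lborel)"
      by (subst mecke_set_bounded) auto
    also have "\<dots> = (\<integral>\<^sup>+p. (SUP n. ennreal (2 * lam) * indicator (?B n \<inter> Hplus) p * (\<integral>\<^sup>+N. indicator A (p, ins p N) \<partial>P)) \<partial>lborel)"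
    proof (rule nn_integral_monotone_convergence_SUP[symmetric])
      show "incseq (\<lambda>n p. ennreal (2 * lam) * indicator (?B n \<inter> Hplus) p * (\<integral>\<^sup>+N. indicator A (p, ins p N) \<partial>P))"
        by (intro monoI le_funI mult_right_mono mult_left_mono) (auto split: split_indicator)
    qed (intro innerR; simp)
    also have "\<dots> = (\<integral>\<^sup>+p. ennreal (2 * lam) * indicator Hplus p * (\<integral>\<^sup>+N. indicator A (p, ins p N) \<partial>P) \<partial>lborel)"
    proof (intro nn_integral_cong antisym SUP_least)
      fix p :: "real \<times> real" and n
      show "ennreal (2 * lam) * indicator (?B n \<inter> Hplus) p * (\<integral>\<^sup>+N. indicator A (p, ins p N) \<partial>P)
        \<le> ennreal (2 * lam) * indicator Hplus p * (\<integral>\<^sup>+N. indicator A (p, ins p N) \<partial>P)"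
        by (auto split: split_indicator)
    next
      fix p :: "real \<times> real"
      obtain n where "norm p \<le> real n" using real_arch_simple by blast
      then show "ennreal (2 * lam) * indicator Hplus p * (\<integral>\<^sup>+N. indicator A (p, ins p N) \<partial>P) \<le>
        (SUP n. ennreal (2 * lam) * indicator (?B n \<inter> Hplus) p * (\<integral>\<^sup>+N. indicator A (p, ins p N) \<partial>P))"
        by (intro SUP_upper2[of n]) (auto split: split_indicator)
    qed
    finally show ?case .
  next
    case (mult u c)
    note u = mult(2)
    have "(\<integral>\<^sup>+N. (\<integral>\<^sup>+p. c * u (p, N) \<partial>count_space N) \<partial>P) = c * (\<integral>\<^sup>+N. (\<integral>\<^sup>+p. u (p, N) \<partial>count_space N) \<partial>P)"
      using sum[OF u] by (simp add: nn_integral_cmult)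
    also have "\<dots> = (\<integral>\<^sup>+p. c * (ennreal (2 * lam) * indicator Hplus p * (\<integral>\<^sup>+N. u (p, ins p N) \<partial>P)) \<partial>lborel)"
      using innerR[OF u, of UNIV] by (subst nn_integral_cmult) (auto simp: mult(4))
    also have "\<dots> = (\<integral>\<^sup>+p. ennreal (2 * lam) * indicator Hplus p * (\<integral>\<^sup>+N. c * u (p, ins p N) \<partial>P) \<partial>lborel)"
      using innerN[OF u] by (intro nn_integral_cong) (simp add: nn_integral_cmult mult_ac)
    finally show ?case .
  next
    case (add u v)
    note u = add(1) and v = add(4)
    have "(\<integral>\<^sup>+N. (\<integral>\<^sup>+p. v (p, N) + u (p, N) \<partial>count_space N) \<partial>P) =
        (\<integral>\<^sup>+N. (\<integral>\<^sup>+p. v (p, N) \<partial>count_space N) \<partial>P) + (\<integral>\<^sup>+N. (\<integral>\<^sup>+p. u (p, N) \<partial>count_space N) \<partial>P)"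
      using sum[OF u] sum[OF v] by (simp add: nn_integral_add)
    also have "\<dots> = (\<integral>\<^sup>+p. ennreal (2 * lam) * indicator Hplus p * (\<integral>\<^sup>+N. v (p, ins p N) \<partial>P)
        + ennreal (2 * lam) * indicator Hplus p * (\<integral>\<^sup>+N. u (p, ins p N) \<partial>P) \<partial>lborel)"
      using innerR[OF u, of UNIV] innerR[OF v, of UNIV] by (subst nn_integral_add) (auto simp: add(3) add(7))
    also have "\<dots> = (\<integral>\<^sup>+p. ennreal (2 * lam) * indicator Hplus p * (\<integral>\<^sup>+N. v (p, ins p N) + u (p, ins p N) \<partial>P) \<partial>lborel)"
      using innerN[OF u] innerN[OF v] by (intro nn_integral_cong) (simp add: nn_integral_add distrib_left)
    finally show ?case .
  next
    case (seq U)
    have "(\<integral>\<^sup>+N. (\<integral>\<^sup>+p. (SUP i. U i) (p, N) \<partial>count_space N) \<partial>P) =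
        (\<integral>\<^sup>+N. (SUP i. \<integral>\<^sup>+p. U i (p, N) \<partial>count_space N) \<partial>P)"
      unfolding SUP_apply using seq(4)
      by (intro nn_integral_cong nn_integral_monotone_convergence_SUP) (auto simp: incseq_def le_fun_def)
    also have "\<dots> = (SUP i. \<integral>\<^sup>+N. (\<integral>\<^sup>+p. U i (p, N) \<partial>count_space N) \<partial>P)"
      using seq(4) by (intro nn_integral_monotone_convergence_SUP sum seq monoI le_funI nn_integral_mono)
        (auto simp: incseq_def le_fun_def)
    also have "\<dots> = (SUP i. \<integral>\<^sup>+p. ennreal (2 * lam) * indicator Hplus p * (\<integral>\<^sup>+N. U i (p, ins p N) \<partial>P) \<partial>lborel)"
      using seq(3) by simp
    also have "\<dots> = (\<integral>\<^sup>+p. (SUP i. ennreal (2 * lam) * indicator Hplus p * (\<integral>\<^sup>+N. U i (p, ins p N) \<partial>P)) \<partial>lborel)"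
    proof (rule nn_integral_monotone_convergence_SUP[symmetric])
      show "incseq (\<lambda>i p. ennreal (2 * lam) * indicator Hplus p * (\<integral>\<^sup>+N. U i (p, ins p N) \<partial>P))"
        using seq(4) by (intro monoI le_funI mult_left_mono nn_integral_mono) (auto simp: incseq_def le_fun_def)
      show "(\<lambda>p. ennreal (2 * lam) * indicator Hplus p * (\<integral>\<^sup>+N. U i (p, ins p N) \<partial>P)) \<in> borel_measurable lborel" for i
        using innerR[OF seq(1)[of i], of UNIV] by simp
    qed
    also have "\<dots> = (\<integral>\<^sup>+p. ennreal (2 * lam) * indicator Hplus p * (\<integral>\<^sup>+N. (SUP i. U i) (p, ins p N) \<partial>P) \<partial>lborel)"
    proof (intro nn_integral_cong)
      fix p :: "real \<times> real"
      have "(\<integral>\<^sup>+N. (SUP i. U i) (p, ins p N) \<partial>P) = (SUP i. \<integral>\<^sup>+N. U i (p, ins p N) \<partial>P)"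
        unfolding SUP_apply
        by (intro nn_integral_monotone_convergence_SUP innerN seq monoI le_funI incseqD[OF seq(4), THEN le_funD])
      then show "(SUP i. ennreal (2 * lam) * indicator Hplus p * (\<integral>\<^sup>+N. U i (p, ins p N) \<partial>P)) =
        ennreal (2 * lam) * indicator Hplus p * (\<integral>\<^sup>+N. (SUP i. U i) (p, ins p N) \<partial>P)"
        by (simp add: SUP_mult_left_ennreal)
    qed
    finally show ?case .
  qed
qed

text \<open>The univariate formula is applied to the outer sum, and then, with \<open>p\<close>
  fixed, to the inner one. In between, the inner sum runs over \<open>ins p N\<close>, which
  contains \<open>p\<close> itself; the assumption on the diagonal removes this term, so that only
  pairs of distinct heads remain.\<close>

lemma mecke_bivariate:
  assumes F [measurable]: "F \<in> borel_measurable (borel \<Otimes>\<^sub>M (borel \<Otimes>\<^sub>M config_space))"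
    and diag: "\<And>p N. F (p, p, N) = 0"
  shows "(\<integral>\<^sup>+N. (\<integral>\<^sup>+p. (\<integral>\<^sup>+q. F (q, p, N) \<partial>count_space N) \<partial>count_space N) \<partial>P) =
    (\<integral>\<^sup>+p. ennreal (2 * lam) * indicator Hplus p *
      (\<integral>\<^sup>+q. ennreal (2 * lam) * indicator Hplus q * (\<integral>\<^sup>+N. F (q, p, ins p (ins q N)) \<partial>P) \<partial>lborel) \<partial>lborel)"
proof -
  define G where "G = (\<lambda>x. \<integral>\<^sup>+q. F (q, x) \<partial>count_space (snd x))"
  have "G \<in> borel_measurable (borel \<Otimes>\<^sub>M config_space)"
    unfolding G_def by (rule borel_measurable_config_sum) (auto intro: F)
  from mecke[OF this]
  have "(\<integral>\<^sup>+N. (\<integral>\<^sup>+p. (\<integral>\<^sup>+q. F (q, p, N) \<partial>count_space N) \<partial>count_space N) \<partial>P) =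
    (\<integral>\<^sup>+p. ennreal (2 * lam) * indicator Hplus p *
      (\<integral>\<^sup>+N. (\<integral>\<^sup>+q. F (q, p, ins p N) \<partial>count_space (ins p N)) \<partial>P) \<partial>lborel)"
    by (simp add: G_def)
  also have "\<dots> = (\<integral>\<^sup>+p. ennreal (2 * lam) * indicator Hplus p *
      (\<integral>\<^sup>+q. ennreal (2 * lam) * indicator Hplus q * (\<integral>\<^sup>+N. F (q, p, ins p (ins q N)) \<partial>P) \<partial>lborel) \<partial>lborel)"
  proof (intro nn_integral_cong)
    fix p :: "real \<times> real"
    have "(\<integral>\<^sup>+N. (\<integral>\<^sup>+q. F (q, p, ins p N) \<partial>count_space (ins p N)) \<partial>P) =
      (\<integral>\<^sup>+q. ennreal (2 * lam) * indicator Hplus q * (\<integral>\<^sup>+N. F (q, p, ins p (ins q N)) \<partial>P) \<partial>lborel)"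
      if p: "p \<in> Hplus"
    proof -
      have "(\<integral>\<^sup>+N. (\<integral>\<^sup>+q. F (q, p, ins p N) \<partial>count_space (ins p N)) \<partial>P) =
        (\<integral>\<^sup>+N. (\<integral>\<^sup>+q. F (q, p, ins p N) \<partial>count_space N) \<partial>P)"
        \<comment> \<open>Passing from \<open>ins p N\<close> to \<open>N\<close> affects at most
          the summand with \<open>q = p\<close>, which is zero.\<close>
        by (intro nn_integral_cong nn_integral_count_space_eq) (auto simp: ins_eq_insert p diag)
      also have "\<dots> = (\<integral>\<^sup>+q. ennreal (2 * lam) * indicator Hplus q * (\<integral>\<^sup>+N. F (q, p, ins p (ins q N)) \<partial>P) \<partial>lborel)"
        using mecke[of "\<lambda>x. F (fst x, p, ins p (snd x))"] by simp
      finally show ?thesis .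
    qed
    then show "ennreal (2 * lam) * indicator Hplus p *
      (\<integral>\<^sup>+N. (\<integral>\<^sup>+q. F (q, p, ins p N) \<partial>count_space (ins p N)) \<partial>P) =
      ennreal (2 * lam) * indicator Hplus p *
      (\<integral>\<^sup>+q. ennreal (2 * lam) * indicator Hplus q * (\<integral>\<^sup>+N. F (q, p, ins p (ins q N)) \<partial>P) \<partial>lborel)"
      by (auto split: split_indicator)
  qed
  finally show ?thesis .
qed

text \<open>Void events are stable under intersection and generate, so a law on configurations is
  determined by its void probabilities. These depend only on \<open>area\<close>, which a horizontal
  translation preserves since it preserves both Lebesgue measure and \<open>Hplus\<close>.\<close>

lemma distr_shift: "distr P config_space (shift a) = P"
proof -
  let ?V = "{void_event D |D. D \<in> sets borel \<and> bounded D}"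
  show ?thesis
  proof (rule measure_eqI_generator_eq[where E = ?V and \<Omega> = configs and A = "\<lambda>_. void_event {}"])
    show "Int_stable ?V" by (rule Int_stable_void_events)
    show "?V \<subseteq> Pow configs" by (auto simp: void_event_def)
    show "sets (distr P config_space (shift a)) = sigma_sets configs ?V" "sets P = sigma_sets configs ?V"
      by (simp_all add: sets_config_space_void)
    show "range (\<lambda>_. void_event {}) \<subseteq> ?V" by auto
    show "(\<Union>i::nat. void_event {}) = configs" by (auto simp: void_event_def)
    have shift_meas: "shift a \<in> measurable P config_space" by measurable
    show "emeasure (distr P config_space (shift a)) (void_event {}) \<noteq> \<infinity>" for i :: nat
      by (subst emeasure_distr[OF shift_meas]) (auto intro: sets_void_event)
    fix X assume "X \<in> ?V"
    then obtain D where X: "X = void_event D" and D [measurable]: "D \<in> sets borel" "bounded D" by auto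
    let ?f = "(+) (- a, 0 :: real)"
    have f: "?f \<in> borel_measurable borel" by measurable
    have "?f -` D = (+) (a, 0) ` D"
      by (force simp: image_iff)
    then have bd: "bounded (?f -` D)"
      using D(2) bounded_translation by auto
    have mD: "?f -` D \<in> sets borel" using measurable_sets[OF f D(1)] by simp
    have "emeasure (distr P config_space (shift a)) X = emeasure P (shift a -` X \<inter> space P)"
      using D by (intro emeasure_distr[OF shift_meas]) (auto simp: X sets_void_event)
    also have "shift a -` X \<inter> space P = void_event (?f -` D)"
      by (auto simp: X void_event_def shift_in_configs shift_disjoint_iff)
    also have "emeasure P \<dots> = ennreal (exp (- (2 * lam * area (?f -` D))))"
      using bd mD by (intro emeasure_void_event)
    also have "area (?f -` D) = measure lborel (?f -` (D \<inter> Hplus))"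
      unfolding area_def by (rule arg_cong[where f = "measure lborel"]) (auto simp: Hplus_def)
    also have "\<dots> = measure (distr lborel borel ?f) (D \<inter> Hplus)"
      by (subst measure_distr) auto
    also have "\<dots> = area D"
      by (simp add: lborel_distr_plus area_def)
    also have "ennreal (exp (- (2 * lam * area D))) = emeasure P X"
      using D by (simp add: X emeasure_void_event)
    finally show "emeasure (distr P config_space (shift a)) X = emeasure P X" .
  qed
qed

lemma nn_integral_shift:
  assumes [measurable]: "g \<in> borel_measurable config_space"
  shows "(\<integral>\<^sup>+N. g (shift a N) \<partial>P) = (\<integral>\<^sup>+N. g N \<partial>P)"
proof -
  have "(\<integral>\<^sup>+N. g N \<partial>P) = (\<integral>\<^sup>+N. g N \<partial>distr P config_space (shift a))"
    by (simp only: distr_shift)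
  also have "\<dots> = (\<integral>\<^sup>+N. g (shift a N) \<partial>P)"
    by (rule nn_integral_distr) measurable
  finally show ?thesis ..
qed

end

section \<open>Handovers as pairs of heads\<close>

text \<open>The geometric meaning of an intersection of birds: at time \<open>s_hat\<close> both
  stations are equally far away, so both heads lie on one half-circle centred at
  \<open>(s_hat, 0)\<close>, whose radius is \<open>h_hat\<close>.\<close>

lemma h_hat_sq_eq_dist:
  assumes "t1 \<noteq> t2"
  shows "h_hat_sq t1 h1 t2 h2 = (t1 - s_hat t1 h1 t2 h2)\<^sup>2 + h1\<^sup>2"
    and "h_hat_sq t1 h1 t2 h2 = (t2 - s_hat t1 h1 t2 h2)\<^sup>2 + h2\<^sup>2"
proof -
  \<comment> \<open>With the difference of the abscissas as a variable, all denominators become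
    multiples of powers of one nonzero quantity.\<close>
  define d where "d = t1 - t2"
  have d: "d \<noteq> 0" and t1: "t1 = t2 + d" using assms by (auto simp: d_def)
  show "h_hat_sq t1 h1 t2 h2 = (t1 - s_hat t1 h1 t2 h2)\<^sup>2 + h1\<^sup>2"
    and "h_hat_sq t1 h1 t2 h2 = (t2 - s_hat t1 h1 t2 h2)\<^sup>2 + h2\<^sup>2"
    using d unfolding h_hat_sq_def s_hat_def t1
    by (simp_all add: field_simps power2_eq_square)
qed

lemma h_hat_squared: "t1 \<noteq> t2 \<Longrightarrow> (h_hat t1 h1 t2 h2)\<^sup>2 = h_hat_sq t1 h1 t2 h2"
  by (simp add: h_hat_def h_hat_sq_eq_dist)

lemma s_hat_commute: "s_hat t1 h1 t2 h2 = s_hat t2 h2 t1 h1"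
proof -
  have "s_hat t2 h2 t1 h1 = (- (t1\<^sup>2 + h1\<^sup>2 - t2\<^sup>2 - h2\<^sup>2)) / (- (2 * (t1 - t2)))"
    unfolding s_hat_def by (rule arg_cong2[where f = "(/)"]) simp_all
  also have "\<dots> = s_hat t1 h1 t2 h2"
    unfolding s_hat_def by (rule minus_divide_divide)
  finally show ?thesis ..
qed

lemma h_hat_commute: "h_hat t1 h1 t2 h2 = h_hat t2 h2 t1 h1"
  by (simp add: h_hat_def h_hat_sq_def power2_commute add.commute)

lemma borel_measurable_s_hat [measurable (raw)]:
  assumes [measurable]: "a \<in> borel_measurable M" "b \<in> borel_measurable M" "c \<in> borel_measurable M" "d \<in> borel_measurable M"
  shows "(\<lambda>x. s_hat (a x) (b x) (c x) (d x)) \<in> borel_measurable M"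
  unfolding s_hat_def by measurable

lemma borel_measurable_h_hat [measurable (raw)]:
  assumes [measurable]: "a \<in> borel_measurable M" "b \<in> borel_measurable M" "c \<in> borel_measurable M" "d \<in> borel_measurable M"
  shows "(\<lambda>x. h_hat (a x) (b x) (c x) (d x)) \<in> borel_measurable M"
  unfolding h_hat_def h_hat_sq_def by measurable

lemma pred_disjoint_U_half [measurable (raw)]:
  assumes s [measurable]: "s \<in> borel_measurable M" and r [measurable]: "r \<in> borel_measurable M"
    and T: "T \<in> measurable M config_space"
  shows "Measurable.pred M (\<lambda>x. T x \<inter> U_half (s x) (r x) = {})"
proof -
  let ?A = "{z \<in> space (borel \<Otimes>\<^sub>M M). snd (fst z) > 0 \<and> (fst (fst z) - s (snd z))\<^sup>2 + (snd (fst z))\<^sup>2 < (r (snd z))\<^sup>2}"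
  have [measurable]: "(\<lambda>z. fst (fst z)) \<in> borel_measurable ((borel :: (real \<times> real) measure) \<Otimes>\<^sub>M M)"
    "(\<lambda>z. snd (fst z)) \<in> borel_measurable ((borel :: (real \<times> real) measure) \<Otimes>\<^sub>M M)"
    by (auto intro: measurable_compose[OF measurable_fst])
  have "?A \<in> sets (borel \<Otimes>\<^sub>M M)" by measurable
  from sets_config_disjoint[OF T this]
  have "{x \<in> space M. T x \<inter> U_half (s x) (r x) = {}} \<in> sets M"
    by (rule back_subst[where P = "\<lambda>X. X \<in> sets M"])
      (auto simp: U_half_def space_pair_measure disjoint_iff)
  then show ?thesis by (simp add: pred_def)
qed

section \<open>Ordered pairs of heads and their circles\<close>

definition pair_s :: "real \<times> real \<Rightarrow> real \<times> real \<Rightarrow> real" where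
  "pair_s p q = s_hat (fst p) (snd p) (fst q) (snd q)"

definition pair_r :: "real \<times> real \<Rightarrow> real \<times> real \<Rightarrow> real" where
  "pair_r p q = h_hat (fst p) (snd p) (fst q) (snd q)"

text \<open>The whole circle is taken instead of its upper half. It is a bounded Borel null set, and
  a configuration can only meet its upper half.\<close>

definition circle :: "real \<times> real \<Rightarrow> real \<times> real \<Rightarrow> (real \<times> real) set" where
  "circle p q = sphere (pair_s p q, 0) (pair_r p q)"

lemma mem_circle_iff:
  assumes "fst q < fst p"
  shows "x \<in> circle p q \<longleftrightarrow> (fst x - pair_s p q)\<^sup>2 + (snd x)\<^sup>2 = (pair_r p q)\<^sup>2"
proof -
  have "pair_r p q \<ge> 0" using assms by (simp add: pair_r_def h_hat_def h_hat_sq_eq_dist)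
  moreover have "dist (pair_s p q, 0) x = sqrt ((fst x - pair_s p q)\<^sup>2 + (snd x)\<^sup>2)"
    by (simp add: dist_prod_def dist_real_def power2_commute)
  moreover have "sqrt y = r \<longleftrightarrow> y = r\<^sup>2" if "y \<ge> 0" "r \<ge> 0" for y r :: real
    using that real_sqrt_pow2[OF that(1)] by auto
  ultimately show ?thesis
    unfolding circle_def by simp
qed

lemma points_on_circle:
  assumes "fst q < fst p"
  shows "(fst p - pair_s p q)\<^sup>2 + (snd p)\<^sup>2 = (pair_r p q)\<^sup>2"
    and "(fst q - pair_s p q)\<^sup>2 + (snd q)\<^sup>2 = (pair_r p q)\<^sup>2"
  using assms by (simp_all add: pair_r_def pair_s_def h_hat_squared h_hat_sq_eq_dist(1)[symmetric]
    h_hat_sq_eq_dist(2)[symmetric])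

text \<open>Centre and radius are symmetric in the two heads, so each pair may be represented by its
  ordering with the later head first. This choice keeps a handover from being counted twice in the
  double sum.\<close>

lemma handover_eq:
  "handover N = {pair_s p q |p q. p \<in> N \<and> q \<in> N \<and> fst q < fst p \<and> N \<inter> U_half (pair_s p q) (pair_r p q) = {}}"
  (is "_ = ?R")
proof
  show "?R \<subseteq> handover N"
    by (force simp: handover_def pair_s_def pair_r_def)
  show "handover N \<subseteq> ?R"
  proof
    fix s assume "s \<in> handover N"
    then obtain t1 h1 t2 h2 where s: "s = s_hat t1 h1 t2 h2" and N: "(t1, h1) \<in> N" "(t2, h2) \<in> N" "t1 \<noteq> t2"
      and e: "N \<inter> U_half (s_hat t1 h1 t2 h2) (h_hat t1 h1 t2 h2) = {}"
      by (auto simp: handover_def)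
    show "s \<in> ?R"
    proof (cases "t2 < t1")
      case True
      then have "s = pair_s (t1, h1) (t2, h2) \<and> (t1, h1) \<in> N \<and> (t2, h2) \<in> N \<and> fst (t2, h2) < fst (t1, h1)
          \<and> N \<inter> U_half (pair_s (t1, h1) (t2, h2)) (pair_r (t1, h1) (t2, h2)) = {}"
        using s N e by (simp add: pair_s_def pair_r_def)
      then show ?thesis by blast
    next
      case False
      then have "s = pair_s (t2, h2) (t1, h1) \<and> (t2, h2) \<in> N \<and> (t1, h1) \<in> N \<and> fst (t1, h1) < fst (t2, h2)
          \<and> N \<inter> U_half (pair_s (t2, h2) (t1, h1)) (pair_r (t2, h2) (t1, h1)) = {}"
        using s N e by (simp add: pair_s_def pair_r_def s_hat_commute[of t2] h_hat_commute[of t2])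
      then show ?thesis by blast
    qed
  qed
qed

text \<open>The argument \<open>q\<close> stands first because its sum is the inner one, matching
  the shape of \<open>mecke_bivariate\<close>; the strict order of the abscissas makes the term
  vanish on the diagonal.\<close>

definition handover_term :: "((real \<times> real) set \<Rightarrow> ennreal) \<Rightarrow> (real \<times> real) \<times> (real \<times> real) \<times> (real \<times> real) set \<Rightarrow> ennreal" where
  "handover_term f = (\<lambda>(q, p, N). if fst q < fst p \<and> N \<inter> U_half (pair_s p q) (pair_r p q) = {} \<and> pair_s p q \<in> {0..1}
     then f (shift (pair_s p q) N) else 0)"

definition no_three_cocircular :: "(real \<times> real) set \<Rightarrow> bool" where
  "no_three_cocircular N \<longleftrightarrow> (\<forall>p\<in>N. \<forall>q\<in>N. fst q < fst p \<longrightarrow> N \<inter> circle p q \<subseteq> {p, q})"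

text \<open>Two pairs with the same abscissa have the same radius, since otherwise the half-disk of the
  larger one would contain the heads of the smaller; all four heads then lie on one circle.\<close>

lemma inj_on_pair_s:
  assumes "N \<subseteq> Hplus" "no_three_cocircular N"
  shows "inj_on (\<lambda>(p, q). pair_s p q)
    {(p, q). p \<in> N \<and> q \<in> N \<and> fst q < fst p \<and> N \<inter> U_half (pair_s p q) (pair_r p q) = {}}"
  (is "inj_on _ ?S")
proof (rule inj_onI)
  fix z z' assume "z \<in> ?S" "z' \<in> ?S" and eq: "(\<lambda>(p, q). pair_s p q) z = (\<lambda>(p, q). pair_s p q) z'"
  then obtain p q p' q' where z: "z = (p, q)" "z' = (p', q')"
    and N: "p \<in> N" "q \<in> N" "p' \<in> N" "q' \<in> N" and lt: "fst q < fst p" "fst q' < fst p'"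
    and e: "N \<inter> U_half (pair_s p q) (pair_r p q) = {}" "N \<inter> U_half (pair_s p' q') (pair_r p' q') = {}"
    by blast
  have s: "pair_s p q = pair_s p' q'" using eq z by simp
  have pos: "snd p > 0" "snd p' > 0" using N assms by (auto simp: Hplus_def)
  have "p \<notin> U_half (pair_s p' q') (pair_r p' q')" "p' \<notin> U_half (pair_s p q) (pair_r p q)"
    using N e by blast+
  then have r: "(pair_r p q)\<^sup>2 = (pair_r p' q')\<^sup>2"
    using pos points_on_circle[OF lt(1)] points_on_circle[OF lt(2)]
    by (auto simp: U_half_def s case_prod_beta)
  have "p' \<in> circle p q" "q' \<in> circle p q"
    unfolding mem_circle_iff[OF lt(1)] s r using points_on_circle[OF lt(2)] by simp_all
  then have "p' \<in> {p, q}" "q' \<in> {p, q}"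
    using assms(2) N lt unfolding no_three_cocircular_def by blast+
  then show "z = z'"
    using lt z by auto
qed

text \<open>An abscissa produced by several pairs would be counted once on the left and several
  times on the right. Absence of cocircular triples makes the abscissa injective on the admissible
  pairs, so the two sums correspond by a bijection.\<close>

lemma sum_handover_eq:
  assumes "N \<subseteq> Hplus" "no_three_cocircular N"
  shows "(\<integral>\<^sup>+s. f (shift s N) \<partial>count_space (handover N \<inter> {0..1})) =
    (\<integral>\<^sup>+p. (\<integral>\<^sup>+q. handover_term f (q, p, N) \<partial>count_space N) \<partial>count_space N)"
proof -
  define S where "S = {(p, q). p \<in> N \<and> q \<in> N \<and> fst q < fst p \<and> N \<inter> U_half (pair_s p q) (pair_r p q) = {} \<and> pair_s p q \<in> {0..1}}"
  have "inj_on (\<lambda>(p, q). pair_s p q) S"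
    by (rule inj_on_subset[OF inj_on_pair_s[OF assms]]) (auto simp: S_def)
  moreover have "(\<lambda>(p, q). pair_s p q) ` S = handover N \<inter> {0..1}"
    unfolding S_def handover_eq by (auto simp: image_iff) blast+
  ultimately have "bij_betw (\<lambda>(p, q). pair_s p q) S (handover N \<inter> {0..1})"
    by (simp add: bij_betw_def)
  from nn_integral_bij_count_space[OF this, of "\<lambda>s. f (shift s N)"]
  have "(\<integral>\<^sup>+s. f (shift s N) \<partial>count_space (handover N \<inter> {0..1})) =
      (\<integral>\<^sup>+z. f (shift ((\<lambda>(p, q). pair_s p q) z) N) \<partial>count_space S)"
    by (simp add: case_prod_beta)
  also have "\<dots> = (\<integral>\<^sup>+z. f (shift ((\<lambda>(p, q). pair_s p q) z) N) * indicator S z \<partial>count_space UNIV)"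
    by (rule nn_integral_count_space_indicator) simp
  also have "\<dots> = (\<integral>\<^sup>+z. (handover_term f (snd z, fst z, N) * indicator N (snd z)) * indicator N (fst z) \<partial>count_space UNIV)"
    by (intro nn_integral_cong) (auto simp: S_def handover_term_def indicator_def)
  also have "\<dots> = (\<integral>\<^sup>+p. (\<integral>\<^sup>+q. (handover_term f (q, p, N) * indicator N q) * indicator N p \<partial>count_space UNIV) \<partial>count_space UNIV)"
    using nn_integral_fst_count_space[of "\<lambda>z. handover_term f (snd z, fst z, N) * indicator N (snd z) * indicator N (fst z)"]
    by simp
  also have "\<dots> = (\<integral>\<^sup>+p. (\<integral>\<^sup>+q. handover_term f (q, p, N) * indicator N q \<partial>count_space UNIV) * indicator N p \<partial>count_space UNIV)"
    by (simp add: nn_integral_multc)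
  also have "\<dots> = (\<integral>\<^sup>+p. (\<integral>\<^sup>+q. handover_term f (q, p, N) \<partial>count_space N) \<partial>count_space N)"
    by (simp add: nn_integral_count_space_indicator[of N])
  finally show ?thesis .
qed

section \<open>Almost sure absence of three cocircular heads\<close>

lemma null_sphere: "emeasure lborel (sphere a r :: (real \<times> real) set) = 0"
proof -
  have "sphere a r \<in> null_sets (lebesgue :: (real \<times> real) measure)"
    using negligible_sphere[of a r] by (simp add: negligible_iff_null_sets)
  then have "sphere a r \<in> null_sets (lborel :: (real \<times> real) measure)"
    by (subst (asm) null_sets_completion_iff) auto
  then show ?thesis by auto
qed

lemma borel_measurable_fst_snd [measurable (raw)]:
  "f \<in> borel_measurable M \<Longrightarrow> (\<lambda>x. fst (f x :: real \<times> real)) \<in> borel_measurable M"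
  "f \<in> borel_measurable M \<Longrightarrow> (\<lambda>x. snd (f x :: real \<times> real)) \<in> borel_measurable M"
  by (auto intro: measurable_compose)

lemma borel_measurable_pair_s_r [measurable (raw)]:
  assumes [measurable]: "p \<in> borel_measurable M" "q \<in> borel_measurable M"
  shows "(\<lambda>x. pair_s (p x) (q x)) \<in> borel_measurable M"
    and "(\<lambda>x. pair_r (p x) (q x)) \<in> borel_measurable M"
  unfolding pair_s_def pair_r_def
  by (intro borel_measurable_s_hat borel_measurable_h_hat borel_measurable_fst_snd assms)+

lemma borel_measurable_handover_term:
  assumes f [measurable]: "f \<in> borel_measurable config_space"
  shows "handover_term f \<in> borel_measurable (borel \<Otimes>\<^sub>M (borel \<Otimes>\<^sub>M config_space))"
proof -
  let ?M = "(borel :: (real \<times> real) measure) \<Otimes>\<^sub>M ((borel :: (real \<times> real) measure) \<Otimes>\<^sub>M config_space)"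
  have q: "(\<lambda>z. fst z) \<in> borel_measurable ?M" and p: "(\<lambda>z. fst (snd z)) \<in> borel_measurable ?M"
    and N [measurable]: "(\<lambda>z. snd (snd z)) \<in> measurable ?M config_space"
    by measurable
  note [measurable] = borel_measurable_fst_snd[OF q] borel_measurable_fst_snd[OF p] borel_measurable_pair_s_r[OF p q]
  have "(\<lambda>z. if fst (fst z) < fst (fst (snd z)) \<and>
      snd (snd z) \<inter> U_half (pair_s (fst (snd z)) (fst z)) (pair_r (fst (snd z)) (fst z)) = {} \<and>
      pair_s (fst (snd z)) (fst z) \<in> {0..1}
      then f (shift (pair_s (fst (snd z)) (fst z)) (snd (snd z))) else 0) \<in> borel_measurable ?M"
    by measurable
  then show ?thesis by (simp add: handover_term_def case_prod_beta)
qed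

context poisson_heads
begin

text \<open>Two applications of the Mecke formula suffice although three heads are involved: the
  existence of the third is absorbed into the summand \<open>F\<close>. Once \<open>p\<close> and
  \<open>q\<close> are inserted as fixed points, a third head has to be a point of \<open>N\<close>
  on a fixed circle, and a circle has area 0 and is therefore almost surely void.\<close>

lemma AE_no_three_cocircular: "AE N in P. no_three_cocircular N"
proof -
  let ?M = "(borel :: (real \<times> real) measure) \<Otimes>\<^sub>M ((borel :: (real \<times> real) measure) \<Otimes>\<^sub>M config_space)"
  \<comment> \<open>The points \<open>fst z\<close>, \<open>fst (snd z)\<close>,
    \<open>fst (snd (snd z))\<close> are the third head, \<open>q\<close> and \<open>p\<close>. The
    two inequalities keep the inserted heads, which lie on their own circle, from being taken for a
    third one.\<close>
  let ?C = "{z \<in> space (borel \<Otimes>\<^sub>M ?M). fst z \<noteq> fst (snd z) \<and> fst z \<noteq> fst (snd (snd z)) \<and>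
    (fst (fst z) - pair_s (fst (snd (snd z))) (fst (snd z)))\<^sup>2 + (snd (fst z))\<^sup>2 = (pair_r (fst (snd (snd z))) (fst (snd z)))\<^sup>2}"
  define F where "F = (\<lambda>z. if fst (fst z) < fst (fst (snd z)) \<and> \<not> (\<forall>x\<in>snd (snd z). (x, z) \<notin> ?C) then 1 else 0 :: ennreal)"
  have F: "F \<in> borel_measurable ?M"
  proof -
    have q: "(\<lambda>z. fst z) \<in> borel_measurable ?M" and p: "(\<lambda>z. fst (snd z)) \<in> borel_measurable ?M"
      and N: "(\<lambda>z. snd (snd z)) \<in> measurable ?M config_space"
      by measurable
    note [measurable] = borel_measurable_fst_snd[OF q] borel_measurable_fst_snd[OF p]
    let ?M' = "(borel :: (real \<times> real) measure) \<Otimes>\<^sub>M ?M"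
    have x': "(\<lambda>z. fst z) \<in> borel_measurable ?M'" and q': "(\<lambda>z. fst (snd z)) \<in> borel_measurable ?M'"
      and p': "(\<lambda>z. fst (snd (snd z))) \<in> borel_measurable ?M'"
      by measurable
    have "?C \<in> sets ?M'"
    proof -
      note [measurable] = borel_measurable_fst_snd[OF x'] borel_measurable_pair_s_r[OF p' q'] x' q' p'
      show ?thesis by measurable
    qed
    from sets_config_disjoint[OF N this]
    have "Measurable.pred ?M (\<lambda>z. \<forall>x\<in>snd (snd z). (x, z) \<notin> ?C)"
      by (simp add: pred_def)
    then show ?thesis unfolding F_def by measurable
  qed
  have diag: "F (p, p, N) = 0" for p N by (simp add: F_def)
  have "(\<integral>\<^sup>+N. F (q, p, ins p (ins q N)) \<partial>P) = 0" if "p \<in> Hplus" "q \<in> Hplus" for p q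
  proof (cases "fst q < fst p")
    case True
    have cm: "circle p q \<in> sets borel" "bounded (circle p q)"
      by (auto simp: circle_def bounded_sphere)
    have "emeasure lborel (circle p q \<inter> Hplus) \<le> emeasure lborel (circle p q)"
      using cm by (intro emeasure_mono) auto
    then have "area (circle p q) = 0"
      by (simp add: area_def circle_def null_sphere measure_def)
    then have "prob (void_event (circle p q)) = 1"
      using prob_void_event[OF cm] by simp
    then have "AE N in P. N \<in> void_event (circle p q)"
      using sets_void_event[OF cm] by (subst (asm) prob_eq_1) auto
    then have "AE N in P. F (q, p, ins p (ins q N)) = 0"
    proof eventually_elim
      case (elim N)
      then show ?case
        using True by (auto simp: F_def void_event_def ins_def mem_circle_iff disjoint_iff)
    qed
    then show ?thesis by (simp cong: nn_integral_cong_AE)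
  qed (simp add: F_def)
  then have "(\<integral>\<^sup>+q. ennreal (2 * lam) * indicator Hplus q * (\<integral>\<^sup>+N. F (q, p, ins p (ins q N)) \<partial>P) \<partial>lborel) =
      (\<integral>\<^sup>+q. 0 \<partial>(lborel :: (real \<times> real) measure))" if "p \<in> Hplus" for p
    using that by (intro nn_integral_cong) (simp split: split_indicator)
  then have zero: "ennreal (2 * lam) * indicator Hplus p *
      (\<integral>\<^sup>+q. ennreal (2 * lam) * indicator Hplus q * (\<integral>\<^sup>+N. F (q, p, ins p (ins q N)) \<partial>P) \<partial>lborel) = 0" for p
    by (simp split: split_indicator)
  have "(\<integral>\<^sup>+N. (\<integral>\<^sup>+p. (\<integral>\<^sup>+q. F (q, p, N) \<partial>count_space N) \<partial>count_space N) \<partial>P) = 0"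
    unfolding mecke_bivariate[OF F diag] zero by simp
  moreover have "(\<lambda>N. \<integral>\<^sup>+p. (\<integral>\<^sup>+q. F (q, p, N) \<partial>count_space N) \<partial>count_space N) \<in> borel_measurable P"
  proof -
    have "(\<lambda>x. \<integral>\<^sup>+q. F (q, x) \<partial>count_space (snd x)) \<in> borel_measurable (borel \<Otimes>\<^sub>M config_space)"
      by (rule borel_measurable_config_sum) (auto intro: F)
    then have "(\<lambda>N. \<integral>\<^sup>+p. (\<integral>\<^sup>+q. F (q, p, N) \<partial>count_space (snd (p, N))) \<partial>count_space N) \<in> borel_measurable config_space"
      by (intro borel_measurable_config_sum[where T = "\<lambda>N. N"]) auto
    then show ?thesis by (simp add: measurable_cong_sets[OF sets_P refl])
  qed
  ultimately have "AE N in P. (\<integral>\<^sup>+p. (\<integral>\<^sup>+q. F (q, p, N) \<partial>count_space N) \<partial>count_space N) = 0"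
    by (subst (asm) nn_integral_0_iff_AE) auto
  then show ?thesis
  proof (rule AE_mp, intro AE_I2 impI)
    fix N assume N: "N \<in> space P" and "(\<integral>\<^sup>+p. (\<integral>\<^sup>+q. F (q, p, N) \<partial>count_space N) \<partial>count_space N) = 0"
    then have F0: "F (q, p, N) = 0" if "p \<in> N" "q \<in> N" for p q
      using that by (simp add: nn_integral_0_iff_AE AE_count_space)
    show "no_three_cocircular N"
      unfolding no_three_cocircular_def
    proof (intro ballI impI subsetI)
      fix p q x assume *: "p \<in> N" "q \<in> N" "fst q < fst p" "x \<in> N \<inter> circle p q"
      show "x \<in> {p, q}"
        using F0[OF *(1,2)] * N
        by (auto simp: F_def mem_circle_iff space_pair_measure split: if_splits)
    qed
  qed
qed

text \<open>Measurability of the sum over \<open>handover N\<close> in \<open>N\<close> is never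
  established. Almost sure equality with the double sum is enough to equate the integrals, and for
  the double sum measurability is available.\<close>

lemma nn_integral_handover_sum:
  assumes f: "f \<in> borel_measurable config_space"
  shows "(\<integral>\<^sup>+N. (\<integral>\<^sup>+s. f (shift s N) \<partial>count_space (handover N \<inter> {0..1})) \<partial>P) =
    (\<integral>\<^sup>+p. ennreal (2 * lam) * indicator Hplus p *
      (\<integral>\<^sup>+q. ennreal (2 * lam) * indicator Hplus q *
        (\<integral>\<^sup>+N. handover_term f (q, p, ins p (ins q N)) \<partial>P) \<partial>lborel) \<partial>lborel)"
proof -
  have "(\<integral>\<^sup>+N. (\<integral>\<^sup>+s. f (shift s N) \<partial>count_space (handover N \<inter> {0..1})) \<partial>P) =
      (\<integral>\<^sup>+N. (\<integral>\<^sup>+p. (\<integral>\<^sup>+q. handover_term f (q, p, N) \<partial>count_space N) \<partial>count_space N) \<partial>P)"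
  proof (rule nn_integral_cong_AE, rule AE_mp[OF AE_no_three_cocircular], intro AE_I2 impI)
    fix N assume "N \<in> space P" "no_three_cocircular N"
    then show "(\<integral>\<^sup>+s. f (shift s N) \<partial>count_space (handover N \<inter> {0..1})) =
        (\<integral>\<^sup>+p. (\<integral>\<^sup>+q. handover_term f (q, p, N) \<partial>count_space N) \<partial>count_space N)"
      by (intro sum_handover_eq) (simp_all add: configs_subset_Hplus)
  qed
  also have "\<dots> = (\<integral>\<^sup>+p. ennreal (2 * lam) * indicator Hplus p *
      (\<integral>\<^sup>+q. ennreal (2 * lam) * indicator Hplus q *
        (\<integral>\<^sup>+N. handover_term f (q, p, ins p (ins q N)) \<partial>P) \<partial>lborel) \<partial>lborel)"
    by (rule mecke_bivariate[OF borel_measurable_handover_term[OF f]]) (simp add: handover_term_def)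
  finally show ?thesis .
qed

end

section \<open>Integrating out the abscissa of the first head\<close>

lemma nn_integral_lborel_prod:
  fixes G :: "real \<times> real \<Rightarrow> ennreal"
  assumes "G \<in> borel_measurable borel"
  shows "(\<integral>\<^sup>+p. G p \<partial>lborel) = (\<integral>\<^sup>+t. \<integral>\<^sup>+h. G (t, h) \<partial>lborel \<partial>lborel)"
proof -
  have "G \<in> borel_measurable (lborel \<Otimes>\<^sub>M lborel)"
    using assms by (simp add: lborel_prod)
  from lborel.nn_integral_fst[OF this] show ?thesis
    by (simp add: lborel_prod)
qed

lemma s_hat_translate:
  assumes "t' \<noteq> 0"
  shows "s_hat t h (t - t') h' = t + s_hat 0 h (- t') h'"
  using assms by (simp add: s_hat_def field_simps power2_eq_square)

lemma h_hat_translate: "h_hat t h (t - t') h' = h_hat 0 h (- t') h'"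
  by (simp add: h_hat_def h_hat_sq_def)

lemma shift_add: "shift (t + s) N = shift s (shift t N)"
  by (auto simp: shift_eq_image image_image algebra_simps)

lemma shift_insert: "shift s (insert p N) = insert (fst p - s, snd p) (shift s N)"
  by (simp add: shift_eq_image)

lemma shift_disjoint_U_half: "shift t N \<inter> U_half s r = {} \<longleftrightarrow> N \<inter> U_half (t + s) r = {}"
  unfolding shift_disjoint_iff by (auto simp: U_half_def disjoint_iff diff_diff_eq)

context poisson_heads
begin

text \<open>The inner expectation of the theorem with \<open>ins\<close> in place of
  \<open>insert\<close>, which makes it measurable in all real parameters at once. For positive
  heights the two versions coincide.\<close>

definition palm_kernel :: "((real \<times> real) set \<Rightarrow> ennreal) \<Rightarrow> real \<Rightarrow> real \<Rightarrow> real \<Rightarrow> ennreal" where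
  "palm_kernel f h h' t' = (\<integral>\<^sup>+N. (if N \<inter> U_half (s_hat 0 h (- t') h') (h_hat 0 h (- t') h') = {}
     then f (shift (s_hat 0 h (- t') h') (ins (0, h) (ins (- t', h') N))) else 0) \<partial>P)"

lemma borel_measurable_palm_kernel [measurable (raw)]:
  assumes [measurable]: "f \<in> borel_measurable config_space"
    "h \<in> borel_measurable M" "h' \<in> borel_measurable M" "t' \<in> borel_measurable M"
  shows "(\<lambda>x. palm_kernel f (h x) (h' x) (t' x)) \<in> borel_measurable M"
  unfolding palm_kernel_def by measurable

text \<open>Writing the earlier head relative to the later one and shifting everything by
  \<open>t\<close> moves the pair to \<open>(0, h)\<close> and \<open>(- t', h')\<close> without
  changing the law of \<open>N\<close>. After that, \<open>t\<close> survives only in the window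
  indicator.\<close>

lemma nn_integral_handover_term:
  assumes f [measurable]: "f \<in> borel_measurable config_space" and pos: "h > 0" "h' > 0" "t' > 0"
  shows "(\<integral>\<^sup>+N. handover_term f ((t - t', h'), (t, h), ins (t, h) (ins (t - t', h') N)) \<partial>P) =
    indicator {0..1} (t + s_hat 0 h (- t') h') * palm_kernel f h h' t'"
proof -
  define s where "s = s_hat 0 h (- t') h'"
  define r where "r = h_hat 0 h (- t') h'"
  define g where "g N = (if N \<inter> U_half s r = {} then f (shift s (ins (0, h) (ins (- t', h') N))) else 0)" for N
  have g [measurable]: "g \<in> borel_measurable config_space"
    unfolding g_def by measurable
  let ?p = "(t, h)" and ?q = "(t - t', h')"
  have ps: "pair_s ?p ?q = t + s" and pr: "pair_r ?p ?q = r"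
    using pos by (simp_all add: pair_s_def pair_r_def s_def r_def s_hat_translate h_hat_translate)
  have H: "?p \<in> Hplus" "?q \<in> Hplus" "(0, h) \<in> Hplus" "(- t', h') \<in> Hplus"
    using pos by (auto simp: Hplus_def)
  have lt: "fst ?q < fst ?p" using pos by simp
  have "handover_term f (?q, ?p, ins ?p (ins ?q N)) = indicator {0..1} (t + s) * g (shift t N)"
    if N: "N \<in> configs" for N
  proof -
    have N': "shift t N \<in> configs" by (rule shift_in_configs[OF N])
    have ins: "ins ?p (ins ?q N) = insert ?p (insert ?q N)"
      using H N ins_in_configs[OF N, of ?q] by (simp add: ins_eq_insert)
    have ins': "ins (0, h) (ins (- t', h') (shift t N)) = insert (0, h) (insert (- t', h') (shift t N))"
      using H N' ins_in_configs[OF N', of "(- t', h')"] by (simp add: ins_eq_insert)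
    \<comment> \<open>The inserted heads lie on the boundary of the open half-disk, hence not in it,
      so emptiness is a condition on \<open>N\<close> alone.\<close>
    have "?p \<notin> U_half (t + s) r" "?q \<notin> U_half (t + s) r"
      using points_on_circle[OF lt] by (auto simp: U_half_def ps pr)
    then have "insert ?p (insert ?q N) \<inter> U_half (t + s) r = {} \<longleftrightarrow> shift t N \<inter> U_half s r = {}"
      by (simp add: shift_disjoint_U_half)
    moreover have "shift (t + s) (insert ?p (insert ?q N)) = shift s (insert (0, h) (insert (- t', h') (shift t N)))"
      by (simp add: shift_add shift_insert)
    ultimately show ?thesis
      using pos by (simp add: handover_term_def ins ins' g_def ps pr split: split_indicator)
  qed
  then have "(\<integral>\<^sup>+N. handover_term f (?q, ?p, ins ?p (ins ?q N)) \<partial>P) =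
      (\<integral>\<^sup>+N. indicator {0..1} (t + s) * g (shift t N) \<partial>P)"
    by (intro nn_integral_cong) simp
  also have "\<dots> = indicator {0..1} (t + s) * (\<integral>\<^sup>+N. g (shift t N) \<partial>P)"
    by (rule nn_integral_cmult) measurable
  also have "(\<integral>\<^sup>+N. g (shift t N) \<partial>P) = palm_kernel f h h' t'"
    unfolding nn_integral_shift[OF g] palm_kernel_def
    by (intro nn_integral_cong) (simp add: g_def s_def r_def)
  finally show ?thesis unfolding s_def .
qed

text \<open>Each of the two heads brings one factor \<open>2 * lam\<close>. For fixed
  \<open>h\<close>, \<open>h'\<close>, \<open>t'\<close> the admissible values of \<open>t\<close>
  form an interval of length 1, so the variable \<open>t\<close> integrates to 1 and leaves the
  triple integral.\<close>

lemma nn_integral_handover_sum_eq: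
  assumes f [measurable]: "f \<in> borel_measurable config_space"
  shows "(\<integral>\<^sup>+N. (\<integral>\<^sup>+s. f (shift s N) \<partial>count_space (handover N \<inter> {0..1})) \<partial>P) =
    ennreal (4 * lam\<^sup>2) * (\<integral>\<^sup>+h\<in>{0<..}. (\<integral>\<^sup>+h'\<in>{0<..}. (\<integral>\<^sup>+t'\<in>{0<..}. palm_kernel f h h' t' \<partial>lborel) \<partial>lborel) \<partial>lborel)"
proof -
  define \<Phi> where "\<Phi> p q = (\<integral>\<^sup>+N. handover_term f (q, p, ins p (ins q N)) \<partial>P)" for p q
  note ht = borel_measurable_handover_term[OF f]
  have \<Phi> [measurable (raw)]: "(\<lambda>x. \<Phi> (p x) (q x)) \<in> borel_measurable M"
    if [measurable]: "p \<in> borel_measurable M" "q \<in> borel_measurable M" for p q and M :: "'m measure"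
  proof -
    note [measurable] = measurable_compose[OF _ ht]
    show ?thesis unfolding \<Phi>_def by measurable
  qed
  define A where "A h t' h' = indicator {0<..} h * indicator {0<..} h' * indicator {0<..} t' * palm_kernel f h h' t'" for h t' h' :: real
  \<comment> \<open>All restrictions of the integration domain are carried as indicators, so that
    the order of integration can be changed freely; \<open>W\<close> is \<open>A\<close> with the
    window condition, the only place where \<open>t\<close> occurs.\<close>
  define W where "W t h t' h' = A h t' h' * indicator {0..1} (t + s_hat 0 h (- t') h')" for t h t' h' :: real
  have A [measurable (raw)]: "(\<lambda>x. A (h x) (t' x) (h' x)) \<in> borel_measurable M"
    if [measurable]: "h \<in> borel_measurable M" "t' \<in> borel_measurable M" "h' \<in> borel_measurable M" for h t' h' and M :: "'m measure"
    unfolding A_def by measurable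
  have W [measurable (raw)]: "(\<lambda>x. W (t x) (h x) (t' x) (h' x)) \<in> borel_measurable M"
    if [measurable]: "t \<in> borel_measurable M" "h \<in> borel_measurable M" "t' \<in> borel_measurable M" "h' \<in> borel_measurable M"
    for t h t' h' and M :: "'m measure"
    unfolding W_def by measurable
  have inner: "indicator Hplus (t, h) * (\<integral>\<^sup>+q. indicator Hplus q * \<Phi> (t, h) q \<partial>lborel) =
      (\<integral>\<^sup>+t'. \<integral>\<^sup>+h'. W t h t' h' \<partial>lborel \<partial>lborel)" for t h
  proof (cases "h > 0")
    case True
    have "(\<integral>\<^sup>+q. indicator Hplus q * \<Phi> (t, h) q \<partial>lborel) =
        (\<integral>\<^sup>+t2. \<integral>\<^sup>+h'. indicator Hplus (t2, h') * \<Phi> (t, h) (t2, h') \<partial>lborel \<partial>lborel)"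
      by (rule nn_integral_lborel_prod) measurable
    \<comment> \<open>Substitution of \<open>t - t'\<close> for \<open>t2\<close>, with Jacobian 1
      in modulus; the order of the two abscissas becomes \<open>t' > 0\<close>.\<close>
    also have "\<dots> = (\<integral>\<^sup>+t'. \<integral>\<^sup>+h'. indicator Hplus (t - t', h') * \<Phi> (t, h) (t - t', h') \<partial>lborel \<partial>lborel)"
      by (subst nn_integral_real_affine[where c = "-1" and t = t]) simp_all
    also have "\<dots> = (\<integral>\<^sup>+t'. \<integral>\<^sup>+h'. W t h t' h' \<partial>lborel \<partial>lborel)"
    proof (intro nn_integral_cong)
      fix t' h' :: real
      show "indicator Hplus (t - t', h') * \<Phi> (t, h) (t - t', h') = W t h t' h'"
      proof (cases "t' > 0 \<and> h' > 0")
        case T: True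
        then show ?thesis
          using True nn_integral_handover_term[OF f True, of h' t' t]
          by (simp add: \<Phi>_def W_def A_def Hplus_def mult.commute)
      next
        case False
        then show ?thesis
          by (auto simp: \<Phi>_def handover_term_def W_def A_def Hplus_def)
      qed
    qed
    finally show ?thesis using True by (simp add: Hplus_def)
  qed (simp add: Hplus_def W_def A_def)
  have "(\<integral>\<^sup>+N. (\<integral>\<^sup>+s. f (shift s N) \<partial>count_space (handover N \<inter> {0..1})) \<partial>P) =
     (\<integral>\<^sup>+p. ennreal (2 * lam) * indicator Hplus p *
      (\<integral>\<^sup>+q. ennreal (2 * lam) * (indicator Hplus q * \<Phi> p q) \<partial>lborel) \<partial>lborel)"
    unfolding nn_integral_handover_sum[OF f] \<Phi>_def by (simp add: mult.assoc)
  also have "\<dots> = (\<integral>\<^sup>+p. ennreal (2 * lam) * ennreal (2 * lam) *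
      (indicator Hplus p * (\<integral>\<^sup>+q. indicator Hplus q * \<Phi> p q \<partial>lborel)) \<partial>lborel)"
    by (intro nn_integral_cong, subst nn_integral_cmult) (auto simp: mult_ac)
  also have "\<dots> = ennreal (2 * lam) * ennreal (2 * lam) *
      (\<integral>\<^sup>+p. indicator Hplus p * (\<integral>\<^sup>+q. indicator Hplus q * \<Phi> p q \<partial>lborel) \<partial>lborel)"
    by (rule nn_integral_cmult) measurable
  also have "ennreal (2 * lam) * ennreal (2 * lam) = ennreal (4 * lam\<^sup>2)"
    using lam_pos by (simp add: power2_eq_square flip: ennreal_mult)
  also have "(\<integral>\<^sup>+p. indicator Hplus p * (\<integral>\<^sup>+q. indicator Hplus q * \<Phi> p q \<partial>lborel) \<partial>lborel) =
      (\<integral>\<^sup>+t. \<integral>\<^sup>+h. \<integral>\<^sup>+t'. \<integral>\<^sup>+h'. W t h t' h' \<partial>lborel \<partial>lborel \<partial>lborel \<partial>lborel)"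
    unfolding inner[symmetric] by (rule nn_integral_lborel_prod) measurable
  \<comment> \<open>Three successive exchanges carry the integral over \<open>t\<close> to the
    innermost position.\<close>
  also have "\<dots> = (\<integral>\<^sup>+h. \<integral>\<^sup>+t. \<integral>\<^sup>+t'. \<integral>\<^sup>+h'. W t h t' h' \<partial>lborel \<partial>lborel \<partial>lborel \<partial>lborel)"
    by (rule lborel_pair.Fubini') measurable
  also have "\<dots> = (\<integral>\<^sup>+h. \<integral>\<^sup>+t'. \<integral>\<^sup>+t. \<integral>\<^sup>+h'. W t h t' h' \<partial>lborel \<partial>lborel \<partial>lborel \<partial>lborel)"
    by (intro nn_integral_cong lborel_pair.Fubini') measurable
  also have "\<dots> = (\<integral>\<^sup>+h. \<integral>\<^sup>+t'. \<integral>\<^sup>+h'. \<integral>\<^sup>+t. W t h t' h' \<partial>lborel \<partial>lborel \<partial>lborel \<partial>lborel)"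
    by (intro nn_integral_cong lborel_pair.Fubini') measurable
  also have "\<dots> = (\<integral>\<^sup>+h. \<integral>\<^sup>+t'. \<integral>\<^sup>+h'. A h t' h' \<partial>lborel \<partial>lborel \<partial>lborel)"
  proof (intro nn_integral_cong)
    fix h t' h' :: real
    let ?s = "s_hat 0 h (- t') h'"
    have "(\<integral>\<^sup>+t. W t h t' h' \<partial>lborel) = A h t' h' * (\<integral>\<^sup>+t. indicator {0..1} (t + ?s) \<partial>lborel)"
      unfolding W_def by (rule nn_integral_cmult) measurable
    also have "(\<integral>\<^sup>+t. indicator {0..1} (t + ?s) \<partial>lborel) = (\<integral>\<^sup>+t. indicator {- ?s..1 - ?s} t \<partial>lborel)"
      by (intro nn_integral_cong) (auto split: split_indicator)
    also have "\<dots> = 1" by simp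
    finally show "(\<integral>\<^sup>+t. W t h t' h' \<partial>lborel) = A h t' h'" by simp
  qed
  also have "\<dots> = (\<integral>\<^sup>+h. \<integral>\<^sup>+h'. \<integral>\<^sup>+t'. A h t' h' \<partial>lborel \<partial>lborel \<partial>lborel)"
    by (intro nn_integral_cong lborel_pair.Fubini') measurable
  also have "\<dots> = (\<integral>\<^sup>+h\<in>{0<..}. (\<integral>\<^sup>+h'\<in>{0<..}. (\<integral>\<^sup>+t'\<in>{0<..}. palm_kernel f h h' t' \<partial>lborel) \<partial>lborel) \<partial>lborel)"
  proof (intro nn_integral_cong)
    fix h :: real
    have "(\<integral>\<^sup>+h'. \<integral>\<^sup>+t'. A h t' h' \<partial>lborel \<partial>lborel) =
        (\<integral>\<^sup>+h'. indicator {0<..} h * ((\<integral>\<^sup>+t'\<in>{0<..}. palm_kernel f h h' t' \<partial>lborel) * indicator {0<..} h') \<partial>lborel)"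
    proof (intro nn_integral_cong)
      fix h' :: real
      have "(\<integral>\<^sup>+t'. A h t' h' \<partial>lborel) = (\<integral>\<^sup>+t'. (indicator {0<..} h * indicator {0<..} h') * (palm_kernel f h h' t' * indicator {0<..} t') \<partial>lborel)"
        by (intro nn_integral_cong) (simp add: A_def mult_ac)
      also have "\<dots> = (indicator {0<..} h * indicator {0<..} h') * (\<integral>\<^sup>+t'\<in>{0<..}. palm_kernel f h h' t' \<partial>lborel)"
        by (rule nn_integral_cmult) measurable
      finally show "(\<integral>\<^sup>+t'. A h t' h' \<partial>lborel) =
        indicator {0<..} h * ((\<integral>\<^sup>+t'\<in>{0<..}. palm_kernel f h h' t' \<partial>lborel) * indicator {0<..} h')"
        by (simp add: mult_ac)
    qed
    also have "\<dots> = indicator {0<..} h * (\<integral>\<^sup>+h'\<in>{0<..}. (\<integral>\<^sup>+t'\<in>{0<..}. palm_kernel f h h' t' \<partial>lborel) \<partial>lborel)"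
      by (rule nn_integral_cmult) measurable
    finally show "(\<integral>\<^sup>+h'. \<integral>\<^sup>+t'. A h t' h' \<partial>lborel \<partial>lborel) =
      (\<integral>\<^sup>+h'\<in>{0<..}. (\<integral>\<^sup>+t'\<in>{0<..}. palm_kernel f h h' t' \<partial>lborel) \<partial>lborel) * indicator {0<..} h"
      by (simp add: mult.commute)
  qed
  finally show ?thesis .
qed

end

section \<open>The handover intensity\<close>

lemma set_nn_integral_UN_incseq:
  assumes [measurable]: "f \<in> borel_measurable M" "\<And>n. A n \<in> sets M" and "incseq A"
  shows "(\<integral>\<^sup>+x\<in>(\<Union>n::nat. A n). f x \<partial>M) = (SUP n. \<integral>\<^sup>+x\<in>A n. f x \<partial>M)"
proof -
  have "(SUP n. emeasure (density M f) (A n)) = emeasure (density M f) (\<Union>n. A n)"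
    using assms by (intro SUP_emeasure_incseq) auto
  then show ?thesis by (simp add: emeasure_density)
qed

lemma UN_compact_exhaustion: "(\<Union>n. {1 / (real n + 1)..real n + 1}) = {0<..}"
proof safe
  fix n and x :: real assume "x \<in> {1 / (real n + 1)..real n + 1}"
  then show "x > 0" by (auto intro: less_le_trans[of 0 "1 / (real n + 1)"])
next
  fix x :: real assume "x > 0"
  obtain n :: nat where n: "max x (1 / x) \<le> real n" using real_arch_simple by blast
  then have "1 / x \<le> real n + 1" "x \<le> real n + 1" by auto
  then have "1 / (real n + 1) \<le> x" using \<open>x > 0\<close> by (simp add: field_simps)
  with \<open>x \<le> real n + 1\<close> show "x \<in> (\<Union>n. {1 / (real n + 1)..real n + 1})" by auto
qed

text \<open>The change of variable v = (1 - \<tau>^2 - \<eta>^2) / (2 \<tau>) for fixed \<tau>. Here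
  \<eta> = sqrt(1 - \<tau>^2 - 2 \<tau> v), so that |d\<eta>/dv| = \<tau> / \<eta> is the weight on
  the right, and \<eta> > 0 turns into \<tau>^2 + 2 \<tau> v < 1. The rule is applied on compact
  intervals, followed by a monotone limit.\<close>

lemma nn_integral_quadratic_substitution:
  fixes G :: "real \<Rightarrow> real"
  assumes [measurable]: "G \<in> borel_measurable borel" and \<tau>: "\<tau> > 0"
  shows "(\<integral>\<^sup>+\<eta>\<in>{0<..}. ennreal (G ((1 - \<tau>\<^sup>2 - \<eta>\<^sup>2) / (2 * \<tau>))) \<partial>lborel) =
    (\<integral>\<^sup>+v\<in>{v. \<tau>\<^sup>2 + 2 * \<tau> * v < 1}. ennreal (G v * (\<tau> / sqrt (1 - \<tau>\<^sup>2 - 2 * \<tau> * v))) \<partial>lborel)"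
proof -
  \<comment> \<open>\<open>g\<close> is minus the new variable, since the substitution rule asks for
    a nonnegative derivative; the sign is undone by a reflection at the end.\<close>
  define g where "g \<eta> = (\<eta>\<^sup>2 + \<tau>\<^sup>2 - 1) / (2 * \<tau>)" for \<eta>
  define f where "f x = G (- x) * (\<tau> / sqrt (1 - \<tau>\<^sup>2 + 2 * \<tau> * x))" for x
  define a b where "a n = 1 / (real n + 1)" and "b n = real n + 1" for n
  have [measurable]: "f \<in> borel_measurable borel" unfolding f_def by measurable
  have ab: "0 < a n" "a n \<le> b n" for n
    by (auto simp: a_def b_def field_simps intro: order_trans[of _ "1 + real n"])
  have g_mono: "g x \<le> g y" if "0 \<le> x" "x \<le> y" for x y
    using that \<tau> by (auto simp: g_def intro!: divide_right_mono power_mono)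
  have sub: "(\<integral>\<^sup>+x\<in>{g (a n)..g (b n)}. ennreal (f x) \<partial>lborel) =
      (\<integral>\<^sup>+\<eta>\<in>{a n..b n}. ennreal (G ((1 - \<tau>\<^sup>2 - \<eta>\<^sup>2) / (2 * \<tau>))) \<partial>lborel)" for n
  proof -
    have "(\<integral>\<^sup>+x. ennreal (f x * indicator {g (a n)..g (b n)} x) \<partial>lborel) =
        (\<integral>\<^sup>+\<eta>. ennreal (f (g \<eta>) * (\<eta> / \<tau>) * indicator {a n..b n} \<eta>) \<partial>lborel)"
    proof (rule nn_integral_substitution)
      show "set_borel_measurable borel {g (a n)..g (b n)} f"
        unfolding set_borel_measurable_def by measurable
      show "(g has_real_derivative x / \<tau>) (at x)" for x
        unfolding g_def using \<tau> by (auto intro!: derivative_eq_intros simp: field_simps)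
      show "continuous_on {a n..b n} (\<lambda>x. x / \<tau>)" using \<tau> by (intro continuous_intros) auto
      show "a n \<le> b n" by (rule ab)
      show "0 \<le> x / \<tau>" if "x \<in> {a n..b n}" for x using that \<tau> ab(1)[of n] by auto
    qed
    moreover have "f (g \<eta>) * (\<eta> / \<tau>) = G ((1 - \<tau>\<^sup>2 - \<eta>\<^sup>2) / (2 * \<tau>))" if "\<eta> > 0" for \<eta>
    proof -
      have "1 - \<tau>\<^sup>2 + 2 * \<tau> * g \<eta> = \<eta>\<^sup>2" using \<tau> by (simp add: g_def)
      moreover have "- g \<eta> = (1 - \<tau>\<^sup>2 - \<eta>\<^sup>2) / (2 * \<tau>)"
        unfolding g_def minus_divide_left by simp
      ultimately show ?thesis using that \<tau> by (simp add: f_def)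
    qed
    ultimately have "(\<integral>\<^sup>+x. ennreal (f x * indicator {g (a n)..g (b n)} x) \<partial>lborel) =
        (\<integral>\<^sup>+\<eta>. ennreal (G ((1 - \<tau>\<^sup>2 - \<eta>\<^sup>2) / (2 * \<tau>)) * indicator {a n..b n} \<eta>) \<partial>lborel)"
      using ab(1)[of n] by (auto simp: indicator_def intro!: nn_integral_cong)
    moreover have "ennreal (u * indicator X x) = ennreal u * indicator X x" for u x :: real and X
      by (simp split: split_indicator)
    ultimately show ?thesis by simp
  qed
  have "(\<integral>\<^sup>+\<eta>\<in>{0<..}. ennreal (G ((1 - \<tau>\<^sup>2 - \<eta>\<^sup>2) / (2 * \<tau>))) \<partial>lborel) =
      (\<integral>\<^sup>+\<eta>\<in>(\<Union>n. {a n..b n}). ennreal (G ((1 - \<tau>\<^sup>2 - \<eta>\<^sup>2) / (2 * \<tau>))) \<partial>lborel)"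
    unfolding a_def b_def UN_compact_exhaustion ..
  also have "\<dots> = (SUP n. \<integral>\<^sup>+\<eta>\<in>{a n..b n}. ennreal (G ((1 - \<tau>\<^sup>2 - \<eta>\<^sup>2) / (2 * \<tau>))) \<partial>lborel)"
  proof (rule set_nn_integral_UN_incseq)
    show "incseq (\<lambda>n. {a n..b n})"
      by (auto simp: incseq_def a_def b_def intro: order_trans[rotated] divide_left_mono)
  qed auto
  also have "\<dots> = (SUP n. \<integral>\<^sup>+x\<in>{g (a n)..g (b n)}. ennreal (f x) \<partial>lborel)"
    by (simp add: sub)
  also have "\<dots> = (\<integral>\<^sup>+x\<in>(\<Union>n. {g (a n)..g (b n)}). ennreal (f x) \<partial>lborel)"
  proof (rule set_nn_integral_UN_incseq[symmetric])
    have "g (a n) \<le> g (a m)" "g (b m) \<le> g (b n)" if "m \<le> n" for m n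
      using that ab(1)[of n] by (auto intro!: g_mono simp: a_def b_def divide_left_mono)
    then show "incseq (\<lambda>n. {g (a n)..g (b n)})"
      by (auto simp: incseq_def intro: order_trans)
  qed auto
  \<comment> \<open>At \<open>x = g \<eta>\<close> the expression on the right equals \<eta>^2, so
    it is positive exactly on the image of the positive half-line.\<close>
  also have "(\<Union>n. {g (a n)..g (b n)}) = {x. 0 < 1 - \<tau>\<^sup>2 + 2 * \<tau> * x}"
  proof safe
    fix n x assume "x \<in> {g (a n)..g (b n)}"
    then have "2 * \<tau> * x \<ge> 2 * \<tau> * g (a n)" using \<tau> by simp
    moreover have "2 * \<tau> * g (a n) = (a n)\<^sup>2 + \<tau>\<^sup>2 - 1" using \<tau> by (simp add: g_def)
    moreover have "(a n)\<^sup>2 > 0" using ab(1)[of n] by simp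
    ultimately show "0 < 1 - \<tau>\<^sup>2 + 2 * \<tau> * x" by linarith
  next
    fix x assume x: "0 < 1 - \<tau>\<^sup>2 + 2 * \<tau> * x"
    define \<eta> where "\<eta> = sqrt (1 - \<tau>\<^sup>2 + 2 * \<tau> * x)"
    have \<eta>: "\<eta> > 0" "g \<eta> = x" using x \<tau> by (auto simp: \<eta>_def g_def)
    then have "\<eta> \<in> (\<Union>n. {a n..b n})" unfolding a_def b_def UN_compact_exhaustion by simp
    then obtain n where "a n \<le> \<eta>" "\<eta> \<le> b n" by auto
    then have "g (a n) \<le> g \<eta>" "g \<eta> \<le> g (b n)" using ab(1)[of n] \<eta> by (auto intro: g_mono)
    then show "x \<in> (\<Union>n. {g (a n)..g (b n)})" using \<eta> by auto
  qed
  also have "(\<integral>\<^sup>+x\<in>{x. 0 < 1 - \<tau>\<^sup>2 + 2 * \<tau> * x}. ennreal (f x) \<partial>lborel) =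
      (\<integral>\<^sup>+v\<in>{v. \<tau>\<^sup>2 + 2 * \<tau> * v < 1}. ennreal (G v * (\<tau> / sqrt (1 - \<tau>\<^sup>2 - 2 * \<tau> * v))) \<partial>lborel)"
    by (subst nn_integral_real_affine[where c = "-1" and t = 0])
      (auto simp: f_def indicator_def algebra_simps intro!: nn_integral_cong)
  finally show ?thesis .
qed

text \<open>Completing the square gives D(\<tau>) = R^2 - (\<tau> + v)^2. Splitting \<tau> = (\<tau>
  + v) - v in the numerator leads to the antiderivative \<open>F\<close>, a square root plus an
  arcsine. The integrand is unbounded near the root of \<open>D\<close>, hence a fundamental theorem
  that differentiates only in the open interval. The nonnegativity of the value is kept for the next
  integral.\<close>

lemma nn_integral_arc:
  fixes v :: real
  shows "(\<integral>\<^sup>+\<tau>. ennreal (\<tau> / sqrt (1 - \<tau>\<^sup>2 - 2 * \<tau> * v)) * indicator {\<tau>. 0 < \<tau> \<and> \<tau>\<^sup>2 + 2 * \<tau> * v < 1} \<tau> \<partial>lborel) =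
      ennreal (1 - v * (pi / 2 - arctan v))"
    and "1 - v * (pi / 2 - arctan v) \<ge> 0"
proof -
  define R where "R = sqrt (1 + v\<^sup>2)"
  define b where "b = R - v"
  define D where "D \<tau> = 1 - \<tau>\<^sup>2 - 2 * \<tau> * v" for \<tau>
  define F where "F \<tau> = - sqrt (D \<tau>) - v * arcsin ((\<tau> + v) / R)" for \<tau>
  have R: "R\<^sup>2 = 1 + v\<^sup>2" "R > 0" by (simp_all add: R_def add_pos_nonneg)
  \<comment> \<open>This makes \<open>b = R - v\<close> the positive root of \<open>D\<close> and
    the other root, \<open>- (R + v)\<close>, negative.\<close>
  have "\<bar>v\<bar> < R" unfolding R_def by (rule real_less_rsqrt) simp
  then have b: "b > 0" and Rv: "R + v > 0" by (auto simp: b_def)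
  have D_R: "D \<tau> = R\<^sup>2 - (\<tau> + v)\<^sup>2" for \<tau>
    unfolding R(1) by (simp add: D_def power2_eq_square algebra_simps)
  have D_fac: "D \<tau> = (b - \<tau>) * (R + v + \<tau>)" for \<tau>
    unfolding D_R b_def by (simp add: power2_eq_square algebra_simps)
  have D_pos: "D \<tau> > 0 \<longleftrightarrow> \<tau> < b" if "\<tau> \<ge> 0" for \<tau>
    using Rv that by (auto simp: D_fac zero_less_mult_iff)
  have D_nonneg: "D \<tau> \<ge> 0" if "0 \<le> \<tau>" "\<tau> \<le> b" for \<tau>
    using Rv that by (auto simp: D_fac)
  have arg: "\<bar>(\<tau> + v) / R\<bar> \<le> 1" if "0 \<le> \<tau>" "\<tau> \<le> b" for \<tau>
    using that R(2) Rv by (auto simp: b_def abs_le_iff field_simps)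
  have arg2: "- 1 \<le> (\<tau> + v) / R" "(\<tau> + v) / R \<le> 1" if "0 \<le> \<tau>" "\<tau> \<le> b" for \<tau>
    using arg[OF that] by linarith+
  have arg': "\<bar>(\<tau> + v) / R\<bar> < 1" if "0 < \<tau>" "\<tau> < b" for \<tau>
    using that R(2) Rv by (auto simp: b_def abs_less_iff field_simps)
  have hi: "((\<lambda>\<tau>. \<tau> / sqrt (D \<tau>)) has_integral (F b - F 0)) {0..b}"
  proof (rule fundamental_theorem_of_calculus_interior)
    show "0 \<le> b" using b by simp
    show "continuous_on {0..b} F"
      unfolding F_def D_def using arg2 R(2) by (intro continuous_intros) auto
  next
    fix \<tau> assume "\<tau> \<in> {0<..<b}"
    then have \<tau>: "0 < \<tau>" "\<tau> < b" by auto
    have Dp: "D \<tau> > 0" using D_pos \<tau> by simp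
    have "1 - ((\<tau> + v) / R)\<^sup>2 = D \<tau> / R\<^sup>2"
      using R(2) by (simp add: D_R power_divide field_simps)
    then have sq: "sqrt (1 - ((\<tau> + v) / R)\<^sup>2) = sqrt (D \<tau>) / R"
      using R(2) by (simp add: real_sqrt_divide)
    have d1: "((\<lambda>\<tau>. sqrt (D \<tau>)) has_real_derivative (- (\<tau> + v) / sqrt (D \<tau>))) (at \<tau>)"
      unfolding D_def using Dp unfolding D_def
      by (auto intro!: derivative_eq_intros simp: divide_simps)
    have d2: "((\<lambda>\<tau>. arcsin ((\<tau> + v) / R)) has_real_derivative (1 / sqrt (D \<tau>))) (at \<tau>)"
    proof (rule DERIV_chain2[where f = arcsin and g = "\<lambda>\<tau>. (\<tau> + v) / R", THEN DERIV_cong])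
      show "DERIV arcsin ((\<tau> + v) / R) :> inverse (sqrt (1 - ((\<tau> + v) / R)\<^sup>2))"
        using arg'[OF \<tau>] by (intro DERIV_arcsin) linarith+
      show "((\<lambda>\<tau>. (\<tau> + v) / R) has_real_derivative 1 / R) (at \<tau>)"
        using R(2) by (auto intro!: derivative_eq_intros)
      show "inverse (sqrt (1 - ((\<tau> + v) / R)\<^sup>2)) * (1 / R) = 1 / sqrt (D \<tau>)"
        unfolding sq using R(2) Dp by (simp add: field_simps)
    qed
    have "(F has_real_derivative (- (- (\<tau> + v) / sqrt (D \<tau>)) - v * (1 / sqrt (D \<tau>)))) (at \<tau>)"
      unfolding F_def by (intro DERIV_diff DERIV_minus DERIV_cmult d1 d2)
    also have "- (- (\<tau> + v) / sqrt (D \<tau>)) - v * (1 / sqrt (D \<tau>)) = \<tau> / sqrt (D \<tau>)"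
      using Dp by (simp add: field_simps)
    finally show "(F has_vector_derivative \<tau> / sqrt (D \<tau>)) (at \<tau>)"
      by (simp add: has_real_derivative_iff_has_vector_derivative)
  qed
  have "v / R = sin (arctan v)" by (simp add: sin_arctan R_def)
  then have as: "arcsin (v / R) = arctan v"
    using arctan_lbound[of v] arctan_ubound[of v] by (simp add: arcsin_sin)
  have b1: "(b + v) / R = 1" using R(2) by (simp add: b_def)
  have "F b = - (v * (pi / 2))"
    unfolding F_def b1 by (simp add: D_fac)
  moreover have "F 0 = - 1 - v * arctan v"
    unfolding F_def add_0_left as by (simp add: D_def)
  ultimately have val: "F b - F 0 = 1 - v * (pi / 2 - arctan v)"
    by (simp add: algebra_simps)
  have nn: "0 \<le> \<tau> / sqrt (D \<tau>)" if "\<tau> \<in> {0..b}" for \<tau>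
    using that D_nonneg by simp
  show "1 - v * (pi / 2 - arctan v) \<ge> 0"
    using has_integral_nonneg[OF hi nn] val by simp
  have "(\<integral>\<^sup>+\<tau>. ennreal (\<tau> / sqrt (D \<tau>)) * indicator {\<tau>. 0 < \<tau> \<and> \<tau>\<^sup>2 + 2 * \<tau> * v < 1} \<tau> \<partial>lborel) =
      (\<integral>\<^sup>+\<tau>. ennreal (\<tau> / sqrt (D \<tau>)) * indicator {0..b} \<tau> \<partial>lborel)"
  proof (intro nn_integral_cong)
    fix \<tau>
    show "ennreal (\<tau> / sqrt (D \<tau>)) * indicator {\<tau>. 0 < \<tau> \<and> \<tau>\<^sup>2 + 2 * \<tau> * v < 1} \<tau> =
      ennreal (\<tau> / sqrt (D \<tau>)) * indicator {0..b} \<tau>"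
    proof (cases "\<tau> > 0")
      case True
      have "\<tau>\<^sup>2 + 2 * \<tau> * v < 1 \<longleftrightarrow> \<tau> < b"
        using D_pos[of \<tau>] True by (simp add: D_def algebra_simps)
      \<comment> \<open>At the endpoint the quotient has denominator 0 and thus value 0, so the
        half-open and the closed interval give the same integrand pointwise.\<close>
      moreover have "D b = 0" by (simp add: D_fac)
      ultimately show ?thesis using True by (cases "\<tau> = b") (auto simp: indicator_def)
    next
      case False
      then show ?thesis by (cases "\<tau> = 0") (auto simp: indicator_def)
    qed
  qed
  also have "\<dots> = ennreal (F b - F 0)"
    by (rule nn_integral_has_integral_lebesgue'[OF nn hi])
  finally show "(\<integral>\<^sup>+\<tau>. ennreal (\<tau> / sqrt (1 - \<tau>\<^sup>2 - 2 * \<tau> * v)) * indicator {\<tau>. 0 < \<tau> \<and> \<tau>\<^sup>2 + 2 * \<tau> * v < 1} \<tau> \<partial>lborel) =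
      ennreal (1 - v * (pi / 2 - arctan v))"
    unfolding D_def val .
qed

text \<open>With v = tan \<theta> the integral becomes that of cos \<theta> - (pi/2 - \<theta>) sin
  \<theta> over (-pi/2, pi/2), which has the antiderivative 2 sin \<theta> + (pi/2 - \<theta>) cos
  \<theta>. This is \<open>F\<close>; its limits at the two ends are -2 and 2.\<close>

lemma nn_integral_arctan_density:
  "(\<integral>\<^sup>+v. ennreal (1 / ((1 + v\<^sup>2) * sqrt (1 + v\<^sup>2)) * (1 - v * (pi / 2 - arctan v))) \<partial>lborel) = 4"
proof -
  define F where "F v = 2 * sin (arctan v) + (pi / 2 - arctan v) * cos (arctan v)" for v :: real
  define f where "f v = 1 / ((1 + v\<^sup>2) * sqrt (1 + v\<^sup>2)) * (1 - v * (pi / 2 - arctan v))" for v :: real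
  have pos: "1 + v\<^sup>2 > 0" for v :: real by (rule add_pos_nonneg) auto
  have deriv: "DERIV F v :> f v" for v
  proof -
    have "DERIV F v :> 2 * (cos (arctan v) * inverse (1 + v\<^sup>2)) +
      ((- inverse (1 + v\<^sup>2)) * cos (arctan v) + (- sin (arctan v) * inverse (1 + v\<^sup>2)) * (pi / 2 - arctan v))"
      unfolding F_def by (auto intro!: derivative_eq_intros)
    also have "2 * (cos (arctan v) * inverse (1 + v\<^sup>2)) +
      ((- inverse (1 + v\<^sup>2)) * cos (arctan v) + (- sin (arctan v) * inverse (1 + v\<^sup>2)) * (pi / 2 - arctan v)) =
      inverse (1 + v\<^sup>2) * (cos (arctan v) - sin (arctan v) * (pi / 2 - arctan v))"
      by (simp add: algebra_simps)
    also have "\<dots> = f v"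
      using pos[of v] unfolding f_def cos_arctan sin_arctan by (simp add: divide_simps)
    finally show ?thesis .
  qed
  have nonneg: "f v \<ge> 0" for v
    using nn_integral_arc(2)[of v] pos[of v] by (simp add: f_def)
  have cont: "isCont f v" for v
    unfolding f_def using pos[of v] by (intro continuous_intros) auto
  have top: "(F \<longlongrightarrow> 2) at_top"
  proof -
    have "(F \<longlongrightarrow> 2 * sin (pi / 2) + (pi / 2 - pi / 2) * cos (pi / 2)) at_top"
      unfolding F_def by (intro tendsto_intros tendsto_arctan_at_top)
    then show ?thesis by simp
  qed
  have bot: "(F \<longlongrightarrow> - 2) at_bot"
  proof -
    have "(F \<longlongrightarrow> 2 * sin (- (pi / 2)) + (pi / 2 - - (pi / 2)) * cos (- (pi / 2))) at_bot"
      unfolding F_def by (intro tendsto_intros tendsto_arctan_at_bot)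
    then show ?thesis by simp
  qed
  have "set_integrable lborel (einterval (-\<infinity>) \<infinity>) f" "(LBINT x=-\<infinity>..\<infinity>. f x) = 2 - (- 2)"
    using deriv cont nonneg top bot
    by (intro interval_integral_FTC_nonneg[where F = F]; simp add: ereal_tendsto_simps)+
  then have "integrable lborel f" "integral\<^sup>L lborel f = 4"
    by (simp_all add: set_integrable_def interval_lebesgue_integral_def set_lebesgue_integral_def)
  then have "(\<integral>\<^sup>+v. ennreal (f v) \<partial>lborel) = ennreal 4"
    using nonneg by (subst nn_integral_eq_integral) auto
  then show ?thesis by (simp add: f_def)
qed

text \<open>Rescaling by sqrt(a) reduces this to the second moment of exp(- x^2) on the half-line,
  which is sqrt(pi) / 4.\<close>

lemma nn_integral_gaussian_second_moment:
  fixes a :: real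
  assumes a: "a > 0"
  shows "(\<integral>\<^sup>+h\<in>{0<..}. ennreal (h\<^sup>2 * exp (- (a * h\<^sup>2))) \<partial>lborel) = ennreal (sqrt pi / (4 * (a * sqrt a)))"
proof -
  let ?I = "\<integral>\<^sup>+h\<in>{0<..}. ennreal (h\<^sup>2 * exp (- (a * h\<^sup>2))) \<partial>lborel"
  have mom: "has_bochner_integral lborel (\<lambda>x::real. indicator {0..} x * (exp (- x\<^sup>2) * x\<^sup>2)) (sqrt pi / 4)"
    using gaussian_moment_even_pos[of 1] by (simp add: fact_numeral)
  then have "(\<integral>\<^sup>+x. ennreal (indicator {0..} x * (exp (- x\<^sup>2) * x\<^sup>2)) \<partial>lborel) = ennreal (sqrt pi / 4)"
    by (subst nn_integral_eq_integral) (auto simp: has_bochner_integral_iff)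
  also have "(\<integral>\<^sup>+x. ennreal (indicator {0..} x * (exp (- x\<^sup>2) * x\<^sup>2)) \<partial>lborel) =
      ennreal (sqrt a) * (\<integral>\<^sup>+x. ennreal (indicator {0..} (0 + sqrt a * x) * (exp (- (0 + sqrt a * x)\<^sup>2) * (0 + sqrt a * x)\<^sup>2)) \<partial>lborel)"
    using a by (subst nn_integral_real_affine[where c = "sqrt a" and t = 0]) auto
  also have "(\<integral>\<^sup>+x. ennreal (indicator {0..} (0 + sqrt a * x) * (exp (- (0 + sqrt a * x)\<^sup>2) * (0 + sqrt a * x)\<^sup>2)) \<partial>lborel) =
      (\<integral>\<^sup>+x. ennreal a * (ennreal (x\<^sup>2 * exp (- (a * x\<^sup>2))) * indicator {0<..} x) \<partial>lborel)"
  proof (intro nn_integral_cong)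
    fix x :: real
    consider "x = 0" | "x > 0" | "x < 0" by linarith
    then show "ennreal (indicator {0..} (0 + sqrt a * x) * (exp (- (0 + sqrt a * x)\<^sup>2) * (0 + sqrt a * x)\<^sup>2)) =
      ennreal a * (ennreal (x\<^sup>2 * exp (- (a * x\<^sup>2))) * indicator {0<..} x)"
      using a by cases (auto simp: power_mult_distrib mult_ac zero_le_mult_iff simp flip: ennreal_mult)
  qed
  also have "\<dots> = ennreal a * ?I"
    by (rule nn_integral_cmult) measurable
  finally have "ennreal (sqrt a * a) * ?I = ennreal (sqrt pi / 4)"
    using a by (simp add: ennreal_mult mult.assoc)
  then have "ennreal (1 / (sqrt a * a)) * (ennreal (sqrt a * a) * ?I) = ennreal (1 / (sqrt a * a)) * ennreal (sqrt pi / 4)"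
    by simp
  also have "ennreal (1 / (sqrt a * a)) * ennreal (sqrt pi / 4) = ennreal (sqrt pi / (4 * (a * sqrt a)))"
    using a by (simp add: mult_ac flip: ennreal_mult)
  also have "ennreal (1 / (sqrt a * a)) * (ennreal (sqrt a * a) * ?I) = ?I"
    using a by (simp add: mult.assoc[symmetric] flip: ennreal_mult)
  finally show ?thesis .
qed

lemma set_nn_integral_scale:
  fixes Q :: "real \<Rightarrow> ennreal"
  assumes [measurable]: "Q \<in> borel_measurable borel" and h: "h > 0"
  shows "(\<integral>\<^sup>+x\<in>{0<..}. Q x \<partial>lborel) = ennreal h * (\<integral>\<^sup>+x\<in>{0<..}. Q (h * x) \<partial>lborel)"
  using h by (subst nn_integral_real_affine[where c = h and t = 0])
    (auto simp: indicator_def zero_less_mult_iff intro!: arg_cong2[where f = "(*)"] nn_integral_cong)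

text \<open>The quotient is the centre of the half-disk for heads \<open>(0, 1)\<close> and
  \<open>(- \<tau>, \<eta>)\<close>, and the integrand is the inverse cube of its radius. It depends
  on the two variables through the centre alone, which is why the centre is a good variable.\<close>

lemma nn_integral_unit_base:
  "(\<integral>\<^sup>+\<eta>\<in>{0<..}. (\<integral>\<^sup>+\<tau>\<in>{0<..}. ennreal (1 / ((1 + ((1 - \<tau>\<^sup>2 - \<eta>\<^sup>2) / (2 * \<tau>))\<^sup>2) *
      sqrt (1 + ((1 - \<tau>\<^sup>2 - \<eta>\<^sup>2) / (2 * \<tau>))\<^sup>2))) \<partial>lborel) \<partial>lborel) = 4"
proof -
  define g where "g v = 1 / ((1 + v\<^sup>2) * sqrt (1 + v\<^sup>2))" for v :: real
  have [measurable]: "g \<in> borel_measurable borel" unfolding g_def by measurable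
  have g_nonneg: "g v \<ge> 0" for v by (simp add: g_def)
  let ?\<sigma> = "\<lambda>\<tau> \<eta> :: real. (1 - \<tau>\<^sup>2 - \<eta>\<^sup>2) / (2 * \<tau>)"
  have "(\<integral>\<^sup>+\<eta>\<in>{0<..}. (\<integral>\<^sup>+\<tau>\<in>{0<..}. ennreal (g (?\<sigma> \<tau> \<eta>)) \<partial>lborel) \<partial>lborel) =
      (\<integral>\<^sup>+\<eta>. (\<integral>\<^sup>+\<tau>. ennreal (g (?\<sigma> \<tau> \<eta>)) * indicator {0<..} \<tau> * indicator {0<..} \<eta> \<partial>lborel) \<partial>lborel)"
    by (intro nn_integral_cong nn_integral_multc[symmetric]) measurable
  also have "\<dots> = (\<integral>\<^sup>+\<tau>. (\<integral>\<^sup>+\<eta>. ennreal (g (?\<sigma> \<tau> \<eta>)) * indicator {0<..} \<tau> * indicator {0<..} \<eta> \<partial>lborel) \<partial>lborel)"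
    by (rule lborel_pair.Fubini') measurable
  also have "\<dots> = (\<integral>\<^sup>+\<tau>. (\<integral>\<^sup>+v. ennreal (g v) * (ennreal (\<tau> / sqrt (1 - \<tau>\<^sup>2 - 2 * \<tau> * v)) *
      indicator {\<tau>. 0 < \<tau> \<and> \<tau>\<^sup>2 + 2 * \<tau> * v < 1} \<tau>) \<partial>lborel) \<partial>lborel)"
  proof (rule nn_integral_cong)
    fix \<tau> :: real
    show "(\<integral>\<^sup>+\<eta>. ennreal (g (?\<sigma> \<tau> \<eta>)) * indicator {0<..} \<tau> * indicator {0<..} \<eta> \<partial>lborel) =
      (\<integral>\<^sup>+v. ennreal (g v) * (ennreal (\<tau> / sqrt (1 - \<tau>\<^sup>2 - 2 * \<tau> * v)) *
      indicator {\<tau>. 0 < \<tau> \<and> \<tau>\<^sup>2 + 2 * \<tau> * v < 1} \<tau>) \<partial>lborel)"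
    proof (cases "\<tau> > 0")
      case True
      then have "(\<integral>\<^sup>+\<eta>. ennreal (g (?\<sigma> \<tau> \<eta>)) * indicator {0<..} \<tau> * indicator {0<..} \<eta> \<partial>lborel) =
        (\<integral>\<^sup>+v\<in>{v. \<tau>\<^sup>2 + 2 * \<tau> * v < 1}. ennreal (g v * (\<tau> / sqrt (1 - \<tau>\<^sup>2 - 2 * \<tau> * v))) \<partial>lborel)"
        using nn_integral_quadratic_substitution[of g \<tau>] by simp
      also have "\<dots> = (\<integral>\<^sup>+v. ennreal (g v) * (ennreal (\<tau> / sqrt (1 - \<tau>\<^sup>2 - 2 * \<tau> * v)) *
        indicator {\<tau>. 0 < \<tau> \<and> \<tau>\<^sup>2 + 2 * \<tau> * v < 1} \<tau>) \<partial>lborel)"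
        using True by (intro nn_integral_cong)
          (simp add: ennreal_mult'[OF g_nonneg] indicator_def del: times_divide_eq_right)
      finally show ?thesis .
    qed (simp add: indicator_def)
  qed
  also have "\<dots> = (\<integral>\<^sup>+v. (\<integral>\<^sup>+\<tau>. ennreal (g v) * (ennreal (\<tau> / sqrt (1 - \<tau>\<^sup>2 - 2 * \<tau> * v)) *
      indicator {\<tau>. 0 < \<tau> \<and> \<tau>\<^sup>2 + 2 * \<tau> * v < 1} \<tau>) \<partial>lborel) \<partial>lborel)"
    unfolding indicator_def mem_Collect_eq by (rule lborel_pair.Fubini') measurable
  also have "\<dots> = (\<integral>\<^sup>+v. ennreal (g v) * ennreal (1 - v * (pi / 2 - arctan v)) \<partial>lborel)"
  proof (intro nn_integral_cong)
    fix v :: real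
    have "(\<lambda>\<tau>. ennreal (\<tau> / sqrt (1 - \<tau>\<^sup>2 - 2 * \<tau> * v)) * indicator {\<tau>. 0 < \<tau> \<and> \<tau>\<^sup>2 + 2 * \<tau> * v < 1} \<tau>) \<in> borel_measurable lborel"
      unfolding indicator_def mem_Collect_eq by measurable
    then show "(\<integral>\<^sup>+\<tau>. ennreal (g v) * (ennreal (\<tau> / sqrt (1 - \<tau>\<^sup>2 - 2 * \<tau> * v)) *
      indicator {\<tau>. 0 < \<tau> \<and> \<tau>\<^sup>2 + 2 * \<tau> * v < 1} \<tau>) \<partial>lborel) = ennreal (g v) * ennreal (1 - v * (pi / 2 - arctan v))"
      by (simp add: nn_integral_cmult nn_integral_arc(1))
  qed
  also have "\<dots> = (\<integral>\<^sup>+v. ennreal (g v * (1 - v * (pi / 2 - arctan v))) \<partial>lborel)"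
    using g_nonneg by (simp add: ennreal_mult')
  also have "\<dots> = 4"
    unfolding g_def by (rule nn_integral_arctan_density)
  finally show ?thesis unfolding g_def .
qed

text \<open>Rescaling \<open>h' = h \<eta>\<close>, \<open>t' = h \<tau>\<close> turns the centre of the half-disk into \<open>h \<sigma>\<close> with
  \<open>\<sigma> = (1 - \<tau>\<^sup>2 - \<eta>\<^sup>2) / (2 \<tau>)\<close> and separates off a Gaussian integral in \<open>h\<close>; in what remains,
  \<open>\<eta>\<close> is replaced by \<open>v = \<sigma>\<close> and the integral over \<open>\<tau>\<close> is done first.\<close>

lemma nn_integral_handover_intensity:
  fixes c :: real
  assumes c: "c > 0"
  shows "(\<integral>\<^sup>+h\<in>{0<..}. (\<integral>\<^sup>+h'\<in>{0<..}. (\<integral>\<^sup>+t'\<in>{0<..}.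
      ennreal (exp (- (c * ((s_hat 0 h (- t') h')\<^sup>2 + h\<^sup>2)))) \<partial>lborel) \<partial>lborel) \<partial>lborel) =
    ennreal (sqrt pi / (c * sqrt c))"
proof -
  define \<sigma> where "\<sigma> \<tau> \<eta> = (1 - \<tau>\<^sup>2 - \<eta>\<^sup>2) / (2 * \<tau>)" for \<tau> \<eta> :: real
  have [measurable (raw)]: "(\<lambda>x. \<sigma> (\<tau> x) (\<eta> x)) \<in> borel_measurable M"
    if [measurable]: "\<tau> \<in> borel_measurable M" "\<eta> \<in> borel_measurable M" for \<tau> \<eta> and M :: "'m measure"
    unfolding \<sigma>_def by measurable
  have s_meas [measurable (raw)]: "(\<lambda>x. s_hat 0 (h x) (- t x) (h' x)) \<in> borel_measurable M"
    if [measurable]: "h \<in> borel_measurable M" "t \<in> borel_measurable M" "h' \<in> borel_measurable M" for h t h' and M :: "'m measure"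
    unfolding s_hat_def by measurable
  define Z where "Z h \<eta> \<tau> = ennreal (h\<^sup>2 * exp (- (c * (1 + (\<sigma> \<tau> \<eta>)\<^sup>2) * h\<^sup>2)))" for h \<eta> \<tau> :: real
  have [measurable (raw)]: "(\<lambda>x. Z (h x) (\<eta> x) (\<tau> x)) \<in> borel_measurable M"
    if [measurable]: "h \<in> borel_measurable M" "\<tau> \<in> borel_measurable M" "\<eta> \<in> borel_measurable M" for h \<tau> \<eta> and M :: "'m measure"
    unfolding Z_def by measurable
  let ?E = "\<lambda>h h' t'. ennreal (exp (- (c * ((s_hat 0 h (- t') h')\<^sup>2 + h\<^sup>2))))"
  \<comment> \<open>The two factors \<open>h\<close> are the Jacobians of the rescalings of
    \<open>h'\<close> and \<open>t'\<close>. Because \<open>s_hat\<close> is homogeneous of degree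
    1, the exponent becomes a multiple of h^2, and a second Gaussian moment results.\<close>
  have E_scale: "ennreal h * (ennreal h * ?E h (h * \<eta>) (h * \<tau>)) = Z h \<eta> \<tau>" if "h > 0" "\<tau> > 0" for h \<eta> \<tau>
  proof -
    have "s_hat 0 h (- (h * \<tau>)) (h * \<eta>) = h * \<sigma> \<tau> \<eta>"
      using that by (simp add: s_hat_def \<sigma>_def field_simps power2_eq_square)
    then have "(s_hat 0 h (- (h * \<tau>)) (h * \<eta>))\<^sup>2 + h\<^sup>2 = (1 + (\<sigma> \<tau> \<eta>)\<^sup>2) * h\<^sup>2"
      by (simp add: power_mult_distrib algebra_simps)
    then show ?thesis
      using that by (simp add: Z_def power2_eq_square mult.assoc flip: ennreal_mult)
  qed
  have scaled: "(\<integral>\<^sup>+h'\<in>{0<..}. (\<integral>\<^sup>+t'\<in>{0<..}. ?E h h' t' \<partial>lborel) \<partial>lborel) =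
      (\<integral>\<^sup>+\<eta>\<in>{0<..}. (\<integral>\<^sup>+\<tau>\<in>{0<..}. Z h \<eta> \<tau> \<partial>lborel) \<partial>lborel)" if h: "h > 0" for h
  proof -
    have "(\<integral>\<^sup>+h'\<in>{0<..}. (\<integral>\<^sup>+t'\<in>{0<..}. ?E h h' t' \<partial>lborel) \<partial>lborel) =
        ennreal h * (\<integral>\<^sup>+\<eta>\<in>{0<..}. (\<integral>\<^sup>+t'\<in>{0<..}. ?E h (h * \<eta>) t' \<partial>lborel) \<partial>lborel)"
      by (rule set_nn_integral_scale[OF _ h]) measurable
    also have "\<dots> = ennreal h * (\<integral>\<^sup>+\<eta>\<in>{0<..}. (ennreal h * (\<integral>\<^sup>+\<tau>\<in>{0<..}. ?E h (h * \<eta>) (h * \<tau>) \<partial>lborel)) \<partial>lborel)"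
    proof -
      have "(\<integral>\<^sup>+t'\<in>{0<..}. ?E h (h * \<eta>) t' \<partial>lborel) = ennreal h * (\<integral>\<^sup>+\<tau>\<in>{0<..}. ?E h (h * \<eta>) (h * \<tau>) \<partial>lborel)" for \<eta>
        by (rule set_nn_integral_scale[OF _ h]) measurable
      then show ?thesis by simp
    qed
    also have "\<dots> = (\<integral>\<^sup>+\<eta>. ennreal h * ((ennreal h * (\<integral>\<^sup>+\<tau>\<in>{0<..}. ?E h (h * \<eta>) (h * \<tau>) \<partial>lborel)) * indicator {0<..} \<eta>) \<partial>lborel)"
      by (rule nn_integral_cmult[symmetric]) measurable
    also have "\<dots> = (\<integral>\<^sup>+\<eta>\<in>{0<..}. (\<integral>\<^sup>+\<tau>\<in>{0<..}. Z h \<eta> \<tau> \<partial>lborel) \<partial>lborel)"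
    proof (intro nn_integral_cong)
      fix \<eta> :: real
      have "ennreal h * (ennreal h * (\<integral>\<^sup>+\<tau>\<in>{0<..}. ?E h (h * \<eta>) (h * \<tau>) \<partial>lborel)) =
          (\<integral>\<^sup>+\<tau>. ennreal h * (ennreal h * (?E h (h * \<eta>) (h * \<tau>) * indicator {0<..} \<tau>)) \<partial>lborel)"
        by (simp add: nn_integral_cmult)
      also have "\<dots> = (\<integral>\<^sup>+\<tau>\<in>{0<..}. Z h \<eta> \<tau> \<partial>lborel)"
        using E_scale[OF h] by (intro nn_integral_cong) (simp split: split_indicator)
      finally show "ennreal h * ((ennreal h * (\<integral>\<^sup>+\<tau>\<in>{0<..}. ?E h (h * \<eta>) (h * \<tau>) \<partial>lborel)) * indicator {0<..} \<eta>) =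
        (\<integral>\<^sup>+\<tau>\<in>{0<..}. Z h \<eta> \<tau> \<partial>lborel) * indicator {0<..} \<eta>"
        by (simp add: mult.assoc[symmetric])
    qed
    finally show ?thesis .
  qed
  let ?J = "\<lambda>h \<eta> \<tau>. Z h \<eta> \<tau> * indicator {0<..} \<tau> * indicator {0<..} \<eta> * indicator {0<..} h"
  have "(\<integral>\<^sup>+h\<in>{0<..}. (\<integral>\<^sup>+h'\<in>{0<..}. (\<integral>\<^sup>+t'\<in>{0<..}. ?E h h' t' \<partial>lborel) \<partial>lborel) \<partial>lborel) =
      (\<integral>\<^sup>+h\<in>{0<..}. (\<integral>\<^sup>+\<eta>\<in>{0<..}. (\<integral>\<^sup>+\<tau>\<in>{0<..}. Z h \<eta> \<tau> \<partial>lborel) \<partial>lborel) \<partial>lborel)"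
    using scaled by (intro nn_integral_cong) (simp split: split_indicator)
  also have "\<dots> = (\<integral>\<^sup>+h. \<integral>\<^sup>+\<eta>. \<integral>\<^sup>+\<tau>. ?J h \<eta> \<tau> \<partial>lborel \<partial>lborel \<partial>lborel)"
    by (simp add: nn_integral_multc)
  also have "\<dots> = (\<integral>\<^sup>+\<eta>. \<integral>\<^sup>+h. \<integral>\<^sup>+\<tau>. ?J h \<eta> \<tau> \<partial>lborel \<partial>lborel \<partial>lborel)"
    by (rule lborel_pair.Fubini') measurable
  also have "\<dots> = (\<integral>\<^sup>+\<eta>. \<integral>\<^sup>+\<tau>. \<integral>\<^sup>+h. ?J h \<eta> \<tau> \<partial>lborel \<partial>lborel \<partial>lborel)"
    by (intro nn_integral_cong lborel_pair.Fubini') measurable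
  also have "\<dots> = (\<integral>\<^sup>+\<eta>. \<integral>\<^sup>+\<tau>. ennreal (sqrt pi / (4 * (c * sqrt c))) *
      (ennreal (1 / ((1 + (\<sigma> \<tau> \<eta>)\<^sup>2) * sqrt (1 + (\<sigma> \<tau> \<eta>)\<^sup>2))) * indicator {0<..} \<tau> * indicator {0<..} \<eta>) \<partial>lborel \<partial>lborel)"
  proof (intro nn_integral_cong)
    fix \<eta> \<tau> :: real
    define q where "q = 1 + (\<sigma> \<tau> \<eta>)\<^sup>2"
    have q: "q > 0" unfolding q_def by (rule add_pos_nonneg) auto
    have "(\<integral>\<^sup>+h. ?J h \<eta> \<tau> \<partial>lborel) = (\<integral>\<^sup>+h. (ennreal (h\<^sup>2 * exp (- (c * q * h\<^sup>2))) * indicator {0<..} h) *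
        (indicator {0<..} \<tau> * indicator {0<..} \<eta>) \<partial>lborel)"
      by (intro nn_integral_cong) (simp add: Z_def q_def mult_ac)
    also have "\<dots> = (\<integral>\<^sup>+h\<in>{0<..}. ennreal (h\<^sup>2 * exp (- (c * q * h\<^sup>2))) \<partial>lborel) * (indicator {0<..} \<tau> * indicator {0<..} \<eta>)"
      by (rule nn_integral_multc) measurable
    also have "(\<integral>\<^sup>+h\<in>{0<..}. ennreal (h\<^sup>2 * exp (- (c * q * h\<^sup>2))) \<partial>lborel) = ennreal (sqrt pi / (4 * (c * q * sqrt (c * q))))"
      using c q by (intro nn_integral_gaussian_second_moment) simp
    also have "\<dots> = ennreal (sqrt pi / (4 * (c * sqrt c))) * ennreal (1 / (q * sqrt q))"
      using c q by (simp add: real_sqrt_mult mult_ac flip: ennreal_mult)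
    finally show "(\<integral>\<^sup>+h. ?J h \<eta> \<tau> \<partial>lborel) = ennreal (sqrt pi / (4 * (c * sqrt c))) *
      (ennreal (1 / ((1 + (\<sigma> \<tau> \<eta>)\<^sup>2) * sqrt (1 + (\<sigma> \<tau> \<eta>)\<^sup>2))) * indicator {0<..} \<tau> * indicator {0<..} \<eta>)"
      by (simp add: q_def mult.assoc)
  qed
  also have "\<dots> = ennreal (sqrt pi / (4 * (c * sqrt c))) *
      (\<integral>\<^sup>+\<eta>\<in>{0<..}. (\<integral>\<^sup>+\<tau>\<in>{0<..}. ennreal (1 / ((1 + (\<sigma> \<tau> \<eta>)\<^sup>2) * sqrt (1 + (\<sigma> \<tau> \<eta>)\<^sup>2))) \<partial>lborel) \<partial>lborel)"
    by (simp add: nn_integral_cmult nn_integral_multc)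
  \<comment> \<open>The value 4 of the rescaled double integral cancels the 4 in the Gaussian
    moment.\<close>
  also have "\<dots> = ennreal (sqrt pi / (4 * (c * sqrt c))) * 4"
    unfolding \<sigma>_def nn_integral_unit_base ..
  also have "\<dots> = ennreal (sqrt pi / (4 * (c * sqrt c))) * ennreal 4"
    by simp
  also have "\<dots> = ennreal (sqrt pi / (4 * (c * sqrt c)) * 4)"
    using c by (intro ennreal_mult[symmetric]) auto
  also have "sqrt pi / (4 * (c * sqrt c)) * 4 = sqrt pi / (c * sqrt c)"
    by simp
  finally show ?thesis .
qed

section \<open>Half-disk areas, the intensity and the Palm formula\<close>

lemma U_half_eq: "r \<ge> 0 \<Longrightarrow> U_half s r = ball (s, 0) r \<inter> Hplus"
  by (auto simp: U_half_def Hplus_def dist_prod_def dist_real_def power2_commute[of s] real_less_lsqrt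
    dest: real_less_lsqrt intro: real_sqrt_less_iff[THEN iffD1])

text \<open>The disk is symmetric in the time axis, and on each vertical line the axis is a single
  point, so the disk splits into two copies of the half-disk up to null sets. The doubled form
  avoids halving in the extended reals.\<close>

lemma emeasure_U_half:
  assumes r: "r \<ge> 0"
  shows "2 * emeasure lborel (U_half s r) = ennreal (pi * r\<^sup>2)"
proof -
  define B where "B = ball (s, 0 :: real) r"
  have [measurable]: "B \<in> sets borel" by (simp add: B_def)
  have B_neg: "(t, - y) \<in> B \<longleftrightarrow> (t, y) \<in> B" for t y
    by (simp add: B_def dist_prod_def dist_real_def)
  have U: "U_half s r = B \<inter> Hplus" using U_half_eq[OF r] by (simp add: B_def)
  have U_meas [measurable]: "U_half s r \<in> sets borel" unfolding U by measurable
  let ?u = "\<lambda>t y. indicator (U_half s r) (t, y) :: ennreal"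
  have "ennreal (pi * r\<^sup>2) = emeasure lborel B"
    using r by (simp add: B_def emeasure_ball unit_ball_vol_2 power2_eq_square)
  also have "\<dots> = (\<integral>\<^sup>+t. \<integral>\<^sup>+y. indicator B (t, y) \<partial>lborel \<partial>lborel)"
    by (subst nn_integral_lborel_prod[symmetric]) auto
  also have "\<dots> = (\<integral>\<^sup>+t. 2 * (\<integral>\<^sup>+y. ?u t y \<partial>lborel) \<partial>lborel)"
  proof (intro nn_integral_cong)
    fix t :: real
    have "(\<integral>\<^sup>+y. indicator B (t, y) \<partial>lborel) = (\<integral>\<^sup>+y. ?u t y + ?u t (- y) \<partial>lborel)"
    proof (rule nn_integral_cong_AE)
      have "AE y in lborel. y \<noteq> (0 :: real)" by (rule AE_lborel_singleton)
      then show "AE y in lborel. indicator B (t, y) = ?u t y + ?u t (- y)"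
        by eventually_elim (auto simp: U Hplus_def B_neg indicator_def)
    qed
    also have "\<dots> = (\<integral>\<^sup>+y. ?u t y \<partial>lborel) + (\<integral>\<^sup>+y. ?u t (- y) \<partial>lborel)"
      by (rule nn_integral_add) measurable
    also have "(\<integral>\<^sup>+y. ?u t (- y) \<partial>lborel) = (\<integral>\<^sup>+y. ?u t y \<partial>lborel)"
      by (subst (2) nn_integral_real_affine[where c = "-1" and t = 0]) simp_all
    finally show "(\<integral>\<^sup>+y. indicator B (t, y) \<partial>lborel) = 2 * (\<integral>\<^sup>+y. ?u t y \<partial>lborel)"
      by (simp add: mult_2)
  qed
  also have "\<dots> = 2 * (\<integral>\<^sup>+t. \<integral>\<^sup>+y. ?u t y \<partial>lborel \<partial>lborel)"
    by (rule nn_integral_cmult) measurable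
  also have "(\<integral>\<^sup>+t. \<integral>\<^sup>+y. ?u t y \<partial>lborel \<partial>lborel) = emeasure lborel (U_half s r)"
    by (subst nn_integral_lborel_prod[symmetric]) auto
  finally show ?thesis ..
qed

context poisson_heads
begin

text \<open>For \<open>f = 1\<close> the inserted heads drop out and a void probability remains.
  Twice the area of the half-disk is pi r^2, and r^2 = s^2 + h^2 because the head
  \<open>(0, h)\<close> lies on its boundary.\<close>

lemma palm_kernel_one:
  assumes "t' > 0"
  shows "palm_kernel (\<lambda>_. 1) h h' t' = ennreal (exp (- (pi * lam * ((s_hat 0 h (- t') h')\<^sup>2 + h\<^sup>2))))"
proof -
  define s r where "s = s_hat 0 h (- t') h'" and "r = h_hat 0 h (- t') h'"
  have r2: "r\<^sup>2 = s\<^sup>2 + h\<^sup>2"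
    using assms unfolding r_def s_def by (subst h_hat_squared) (auto simp: h_hat_sq_eq_dist(1))
  have r: "r \<ge> 0"
    unfolding r_def h_hat_def using assms by (simp add: h_hat_sq_eq_dist(1))
  have U: "U_half s r \<in> sets borel" "bounded (U_half s r)" "U_half s r \<inter> Hplus = U_half s r"
    unfolding U_half_eq[OF r] by (auto intro: bounded_subset[OF bounded_ball])
  have "2 * ennreal (area (U_half s r)) = ennreal (pi * r\<^sup>2)"
    using emeasure_U_half[OF r, of s] emeasure_area[OF U(2,1)] by (simp add: U(3))
  then have "ennreal (2 * area (U_half s r)) = ennreal (pi * r\<^sup>2)"
    by (simp add: ennreal_mult)
  then have area: "2 * area (U_half s r) = pi * r\<^sup>2"
    by (subst (asm) ennreal_inj) auto
  have "palm_kernel (\<lambda>_. 1) h h' t' = (\<integral>\<^sup>+N. indicator (void_event (U_half s r)) N \<partial>P)"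
    unfolding palm_kernel_def s_def r_def by (intro nn_integral_cong) (simp add: void_event_def)
  also have "\<dots> = ennreal (exp (- (2 * lam * area (U_half s r))))"
    using sets_void_event[OF U(1,2)] emeasure_void_event[OF U(1,2)] by simp
  also have "2 * lam * area (U_half s r) = pi * lam * (s\<^sup>2 + h\<^sup>2)"
    using area r2 by (simp add: algebra_simps)
  finally show ?thesis unfolding s_def .
qed

lemma nn_integral_palm_kernel_one:
  "(\<integral>\<^sup>+h\<in>{0<..}. (\<integral>\<^sup>+h'\<in>{0<..}. (\<integral>\<^sup>+t'\<in>{0<..}. palm_kernel (\<lambda>_. 1) h h' t' \<partial>lborel) \<partial>lborel) \<partial>lborel) =
    ennreal (1 / (pi * lam powr (3/2)))"
proof -
  have "(\<integral>\<^sup>+t'\<in>{0<..}. palm_kernel (\<lambda>_. 1) h h' t' \<partial>lborel) =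
      (\<integral>\<^sup>+t'\<in>{0<..}. ennreal (exp (- (pi * lam * ((s_hat 0 h (- t') h')\<^sup>2 + h\<^sup>2)))) \<partial>lborel)" for h h'
    by (intro nn_integral_cong) (simp add: palm_kernel_one split: split_indicator)
  then have "(\<integral>\<^sup>+h\<in>{0<..}. (\<integral>\<^sup>+h'\<in>{0<..}. (\<integral>\<^sup>+t'\<in>{0<..}. palm_kernel (\<lambda>_. 1) h h' t' \<partial>lborel) \<partial>lborel) \<partial>lborel) =
      ennreal (sqrt pi / (pi * lam * sqrt (pi * lam)))"
    using nn_integral_handover_intensity[of "pi * lam"] lam_pos by simp
  also have "sqrt pi / (pi * lam * sqrt (pi * lam)) = 1 / (pi * (lam * sqrt lam))"
    using lam_pos by (simp add: real_sqrt_mult)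
  also have "lam * sqrt lam = lam powr (3/2)"
    using lam_pos powr_add[of lam 1 "1/2"] by (simp add: powr_half_sqrt)
  finally show ?thesis .
qed

text \<open>Numerator and denominator carry the same factor 4 lam^2, which cancels; what remains is
  the reciprocal of the triple integral for \<open>f = 1\<close>. The quotient \<open>c / k\<close>
  is the intensity 4 sqrt(lam) / pi.\<close>

lemma palm_expectation_handover:
  assumes f: "f \<in> borel_measurable config_space"
  shows "palm_expectation P handover f = ennreal (pi * lam powr (3/2)) *
    (\<integral>\<^sup>+h\<in>{0<..}. (\<integral>\<^sup>+h'\<in>{0<..}. (\<integral>\<^sup>+t'\<in>{0<..}. palm_kernel f h h' t' \<partial>lborel) \<partial>lborel) \<partial>lborel)"
    (is "_ = _ * ?X")
proof -
  define c where "c = 4 * lam\<^sup>2"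
  define k where "k = pi * lam powr (3/2)"
  have c: "c > 0" and k: "k > 0" using lam_pos by (auto simp: c_def k_def)
  have "(\<integral>\<^sup>+N. emeasure (count_space (handover N \<inter> {0..1})) (handover N \<inter> {0..1}) \<partial>P) =
      (\<integral>\<^sup>+N. (\<integral>\<^sup>+s. (\<lambda>_. 1) (shift s N) \<partial>count_space (handover N \<inter> {0..1})) \<partial>P)"
    by simp
  also have "\<dots> = ennreal c * ennreal (1 / k)"
    unfolding c_def k_def nn_integral_palm_kernel_one[symmetric] by (rule nn_integral_handover_sum_eq) simp
  also have "\<dots> = ennreal (c / k)"
    using c k by (simp flip: ennreal_mult)
  finally have "palm_expectation P handover f = (ennreal c * ?X) / ennreal (c / k)"
    unfolding palm_expectation_def nn_integral_handover_sum_eq[OF f] c_def by simp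
  also have "\<dots> = ennreal k * ?X"
  \<comment> \<open>The intensity is positive and finite, so dividing by it is multiplication by a
    genuine inverse even if the triple integral is infinite.\<close>
  proof -
    have "inverse (ennreal (c / k)) = ennreal (k / c)"
      using c k by (simp add: inverse_ennreal)
    moreover have "ennreal (k / c) * ennreal c = ennreal k"
      using c k by (simp flip: ennreal_mult)
    ultimately show ?thesis
      by (metis (no_types, lifting) divide_ennreal_def mult.assoc mult.commute)
  qed
  finally show ?thesis unfolding k_def .
qed

end

theorem theorem5p4:
  fixes lam :: real
    and P :: "(real \<times> real) set measure"
    and f :: "(real \<times> real) set \<Rightarrow> ennreal"
  assumes "lam > 0"
    and "poisson_head_law lam P"
    and "f \<in> borel_measurable config_space"
  shows "palm_expectation P handover f =
    ennreal (pi * lam powr (3/2)) *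
      (\<integral>\<^sup>+ h \<in> {0<..}. (\<integral>\<^sup>+ h' \<in> {0<..}. (\<integral>\<^sup>+ t' \<in> {0<..}.
          (\<integral>\<^sup>+ N. (if N \<inter> U_half (s_hat 0 h (- t') h') (h_hat 0 h (- t') h') = {}
                     then f (shift (s_hat 0 h (- t') h') (insert (0, h) (insert (- t', h') N)))
                     else 0) \<partial>P)
        \<partial>lborel) \<partial>lborel) \<partial>lborel)"
proof -
  interpret poisson_heads lam P
    using assms by unfold_locales
  \<comment> \<open>Agreement is claimed only for positive heights, where no inserted point is
    removed by the intersection with \<open>Hplus\<close>; the domains of integration need nothing
    else.\<close>
  have kernel: "palm_kernel f h h' t' =
      (\<integral>\<^sup>+ N. (if N \<inter> U_half (s_hat 0 h (- t') h') (h_hat 0 h (- t') h') = {}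
                 then f (shift (s_hat 0 h (- t') h') (insert (0, h) (insert (- t', h') N)))
                 else 0) \<partial>P)" if "h > 0" "h' > 0" for h h' t'
    unfolding palm_kernel_def
  proof (intro nn_integral_cong)
    fix N assume "N \<in> space P"
    then have N: "N \<in> configs" by simp
    have "ins (0, h) (ins (- t', h') N) = insert (0, h) (insert (- t', h') N)"
      using that N ins_in_configs[OF N, of "(- t', h')"] by (simp add: ins_eq_insert Hplus_def)
    then show "(if N \<inter> U_half (s_hat 0 h (- t') h') (h_hat 0 h (- t') h') = {}
        then f (shift (s_hat 0 h (- t') h') (ins (0, h) (ins (- t', h') N))) else 0) =
      (if N \<inter> U_half (s_hat 0 h (- t') h') (h_hat 0 h (- t') h') = {}
        then f (shift (s_hat 0 h (- t') h') (insert (0, h) (insert (- t', h') N))) else 0)"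
      by simp
  qed
  have set_cong: "(\<integral>\<^sup>+x\<in>{0<..}. u x \<partial>lborel) = (\<integral>\<^sup>+x\<in>{0<..}. v x \<partial>lborel)"
    if "\<And>x. x > 0 \<Longrightarrow> u x = v x" for u v :: "real \<Rightarrow> ennreal"
    using that by (intro nn_integral_cong) (simp split: split_indicator)
  show ?thesis
    unfolding palm_expectation_handover[OF assms(3)]
    by (rule arg_cong[where f = "(*) (ennreal (pi * lam powr (3/2)))"]) (intro set_cong kernel)
qed


end
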